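(* Let $\alpha$ be an ergodic strongly continuous action of $G$ on a complete order-unit space $(\bar A,e)$. Define the (possibly $+\infty$-valued) seminorm $L$ on $\bar A$ by $L(a)=\sup\{\|\alpha_x(a)-a\|/l(x):x\in G,\ x\ne e_G\}$, and let $A=\{a\in\bar A:L(a)<\infty\}$. If the restriction of $L$ to $A$ is a Lip-norm, then $\alpha$ is of finite multiplicity.
   Context: $G$ is a nontrivial compact group with identity $e_G$ and a fixed length function $l$, i.e. a continuous function $l:G\to\mathbb{R}$ with $l(xy)\le l(x)+l(y)$, $l(x^{-1})=l(x)$, and $l(x)=0$ if and only if $x=e_G$. $\hat G$ is the set of equivalence classes of irreducible representations of $G$. An order-unit space is a real partially ordered vector space $A$ with a distinguished element $e=e_A$ (the order unit) such that (i) for each $a\in A$ there is $r\in\mathbb{R}$ with $a\le re$; (ii) if $a\le re$ for all real $r>0$ then $a\le 0$. Its norm is $\|a\|=\inf\{r\in\mathbb{R}:-re\le a\le re\}$. A state is a $\mu$ in the dual $A'$ with $\mu(e)=\|\mu\|'=1$; $S(A)$ is the (nonempty) set of states with the weak-$*$ topology. For a seminorm $L$ on $A$ put $\rho_L(\mu,\nu)=\sup\{|\mu(a)-\nu(a)|:a\in A,\ L(a)\le1\}$. $L$ is a Lip-norm on $A$ if (1) $L(a)=0$ if and only if $a\in\mathbb{R}e$; (2) the topology on $S(A)$ induced by $\rho_L$ is the weak-$*$ topology. Actions of $G$ on a complete order-unit space $(\bar A,e)$ are by automorphisms of order-unit spaces; strong continuity means $x\mapsto\alpha_x(a)$ is norm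 continuous for each $a$. $\alpha$ is ergodic if the only $\alpha$-invariant elements are scalar multiples of $e$. $\bar A^{\mathbb{C}}=\bar A\otimes_{\mathbb{R}}\mathbb{C}$ carries the action $\alpha\otimes I$; $\mathrm{mul}(\bar A^{\mathbb{C}},\gamma)$ is the multiplicity of $\gamma\in\hat G$ in it; $\alpha$ is of finite multiplicity if $\mathrm{mul}(\bar A^{\mathbb{C}},\gamma)<\infty$ for all $\gamma\in\hat G$. It is known that $A$ is a dense subspace of $\bar A$ containing $e$. *)

theory Defs
  imports
    "HOL-Analysis.Analysis"
    "HOL-Library.Extended_Nat"
    "Jordan_Normal_Form.Matrix"
begin

text \<open>
  Groups are written additively, as the library's type class for topological groups is
  \<open>topological_group_add\<close>; it does not include commutativity. The identity is \<open>0\<close>.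
\<close>

definition length_function :: "('g::topological_group_add \<Rightarrow> real) \<Rightarrow> bool" where
  "length_function l \<longleftrightarrow>
     continuous_on UNIV l \<and>
     (\<forall>x y. l (x + y) \<le> l x + l y) \<and>
     (\<forall>x. l (- x) = l x) \<and>
     (\<forall>x. l x = 0 \<longleftrightarrow> x = 0)"


section \<open>Order-unit spaces\<close>

text \<open>
  An order-unit space is a linear subspace \<open>A\<close>, containing the order unit \<open>e\<close>, of an ambient
  partially ordered real vector space, with the inherited order.
\<close>

definition order_unit_space :: "'a::ordered_real_vector set \<Rightarrow> 'a \<Rightarrow> bool" where
  "order_unit_space A e \<longleftrightarrow>
     subspace A \<and> e \<in> A \<and>
     (\<forall>a\<in>A. \<exists>r. a \<le> r *\<^sub>R e) \<and>
     (\<forall>a\<in>A. (\<forall>r>0. a \<le> r *\<^sub>R e) \<longrightarrow> a \<le> 0)"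

definition ou_norm :: "'a::ordered_real_vector \<Rightarrow> 'a \<Rightarrow> real" where
  "ou_norm e a = Inf {r. - (r *\<^sub>R e) \<le> a \<and> a \<le> r *\<^sub>R e}"

text \<open>Completeness is the type class \<open>banach\<close>, whose norm is required to be the order-unit norm.\<close>

definition complete_order_unit_space :: "'a::{banach, ordered_real_vector} \<Rightarrow> bool" where
  "complete_order_unit_space e \<longleftrightarrow>
     order_unit_space UNIV e \<and> (\<forall>a. norm a = ou_norm e a)"

text \<open>
  Functionals on \<open>A\<close> are extensional functions, so that each is determined by its values on \<open>A\<close>.
\<close>

definition ou_dual :: "'a::ordered_real_vector set \<Rightarrow> 'a \<Rightarrow> ('a \<Rightarrow> real) set" where
  "ou_dual A e = {\<mu> \<in> extensional A.
     (\<forall>a\<in>A. \<forall>b\<in>A. \<mu> (a + b) = \<mu> a + \<mu> b) \<and>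
     (\<forall>c. \<forall>a\<in>A. \<mu> (c *\<^sub>R a) = c * \<mu> a) \<and>
     (\<exists>C. \<forall>a\<in>A. \<bar>\<mu> a\<bar> \<le> C * ou_norm e a)}"

definition ou_dual_norm :: "'a::ordered_real_vector set \<Rightarrow> 'a \<Rightarrow> ('a \<Rightarrow> real) \<Rightarrow> real" where
  "ou_dual_norm A e \<mu> = (SUP a\<in>{a\<in>A. ou_norm e a \<le> 1}. \<bar>\<mu> a\<bar>)"

definition states :: "'a::ordered_real_vector set \<Rightarrow> 'a \<Rightarrow> ('a \<Rightarrow> real) set" where
  "states A e = {\<mu> \<in> ou_dual A e. \<mu> e = 1 \<and> ou_dual_norm A e \<mu> = 1}"

definition weak_star_states :: "'a::ordered_real_vector set \<Rightarrow> 'a \<Rightarrow> ('a \<Rightarrow> real) topology" where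
  "weak_star_states A e = subtopology (product_topology (\<lambda>_. euclideanreal) A) (states A e)"


section \<open>Lip-norms\<close>

definition rho :: "'a set \<Rightarrow> ('a \<Rightarrow> real) \<Rightarrow> ('a \<Rightarrow> real) \<Rightarrow> ('a \<Rightarrow> real) \<Rightarrow> ennreal" where
  "rho A L \<mu> \<nu> = (SUP a\<in>{a\<in>A. L a \<le> 1}. ennreal \<bar>\<mu> a - \<nu> a\<bar>)"

text \<open>The metric topology of \<open>rho\<close>, which may take the value \<open>\<infinity>\<close>.\<close>

definition rho_topology ::
    "'a::ordered_real_vector set \<Rightarrow> 'a \<Rightarrow> ('a \<Rightarrow> real) \<Rightarrow> ('a \<Rightarrow> real) topology" where
  "rho_topology A e L = topology (\<lambda>U. U \<subseteq> states A e \<and>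
     (\<forall>\<mu>\<in>U. \<exists>r>0. \<forall>\<nu>\<in>states A e. rho A L \<mu> \<nu> < ennreal r \<longrightarrow> \<nu> \<in> U))"

lemma openin_rho_topology:
  "openin (rho_topology A e L) U \<longleftrightarrow> U \<subseteq> states A e \<and>
     (\<forall>\<mu>\<in>U. \<exists>r>0. \<forall>\<nu>\<in>states A e. rho A L \<mu> \<nu> < ennreal r \<longrightarrow> \<nu> \<in> U)"
proof -
  let ?P = "\<lambda>U. U \<subseteq> states A e \<and>
     (\<forall>\<mu>\<in>U. \<exists>r>0. \<forall>\<nu>\<in>states A e. rho A L \<mu> \<nu> < ennreal r \<longrightarrow> \<nu> \<in> U)"
  have inter: "?P (S \<inter> T)" if S: "?P S" and T: "?P T" for S T
  proof (intro conjI ballI)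
    show "S \<inter> T \<subseteq> states A e" using S by blast
    fix \<mu> assume \<mu>: "\<mu> \<in> S \<inter> T"
    obtain r where r: "r > 0"
      "\<And>\<nu>. \<nu> \<in> states A e \<Longrightarrow> rho A L \<mu> \<nu> < ennreal r \<Longrightarrow> \<nu> \<in> S"
      using S \<mu> by (metis IntD1)
    obtain s where s: "s > 0"
      "\<And>\<nu>. \<nu> \<in> states A e \<Longrightarrow> rho A L \<mu> \<nu> < ennreal s \<Longrightarrow> \<nu> \<in> T"
      using T \<mu> by (metis IntD2)
    have "\<nu> \<in> S \<inter> T" if "\<nu> \<in> states A e" "rho A L \<mu> \<nu> < ennreal (min r s)" for \<nu>
    proof -
      have "rho A L \<mu> \<nu> < ennreal r" "rho A L \<mu> \<nu> < ennreal s"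
        using that(2) order.strict_trans2[OF that(2) ennreal_leI] by simp_all
      then show ?thesis using r(2) s(2) that(1) by blast
    qed
    then show "\<exists>r>0. \<forall>\<nu>\<in>states A e. rho A L \<mu> \<nu> < ennreal r \<longrightarrow> \<nu> \<in> S \<inter> T"
      using r(1) s(1) by (intro exI[of _ "min r s"]) auto
  qed
  have union: "?P (\<Union>K)" if K: "\<forall>U\<in>K. ?P U" for K
  proof (intro conjI ballI)
    show "\<Union>K \<subseteq> states A e" using K by blast
    fix \<mu> assume "\<mu> \<in> \<Union>K"
    then obtain U where U: "U \<in> K" "\<mu> \<in> U" by blast
    then obtain r where "r > 0" "\<forall>\<nu>\<in>states A e. rho A L \<mu> \<nu> < ennreal r \<longrightarrow> \<nu> \<in> U"
      using K by metis
    then show "\<exists>r>0. \<forall>\<nu>\<in>states A e. rho A L \<mu> \<nu> < ennreal r \<longrightarrow> \<nu> \<in> \<Union>K"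
      using U(1) by blast
  qed
  have "istopology ?P"
    unfolding istopology_def using inter union by blast
  from topology_inverse'[OF this] show ?thesis
    unfolding rho_topology_def by simp
qed

definition seminorm_on :: "'a::real_vector set \<Rightarrow> ('a \<Rightarrow> real) \<Rightarrow> bool" where
  "seminorm_on A L \<longleftrightarrow>
     (\<forall>a\<in>A. \<forall>b\<in>A. L (a + b) \<le> L a + L b) \<and>
     (\<forall>c. \<forall>a\<in>A. L (c *\<^sub>R a) = \<bar>c\<bar> * L a)"

definition Lip_norm :: "'a::ordered_real_vector set \<Rightarrow> 'a \<Rightarrow> ('a \<Rightarrow> real) \<Rightarrow> bool" where
  "Lip_norm A e L \<longleftrightarrow>
     seminorm_on A L \<and>
     (\<forall>a\<in>A. L a = 0 \<longleftrightarrow> a \<in> range (\<lambda>r. r *\<^sub>R e)) \<and>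
     rho_topology A e L = weak_star_states A e"


section \<open>Actions on order-unit spaces\<close>

definition ou_automorphism :: "'a::ordered_real_vector \<Rightarrow> ('a \<Rightarrow> 'a) \<Rightarrow> bool" where
  "ou_automorphism e f \<longleftrightarrow>
     linear f \<and> bij f \<and> (\<forall>a b. f a \<le> f b \<longleftrightarrow> a \<le> b) \<and> f e = e"

definition ou_action ::
    "'a::ordered_real_vector \<Rightarrow> ('g::group_add \<Rightarrow> 'a \<Rightarrow> 'a) \<Rightarrow> bool" where
  "ou_action e \<alpha> \<longleftrightarrow>
     (\<forall>x. ou_automorphism e (\<alpha> x)) \<and>
     \<alpha> 0 = id \<and> (\<forall>x y. \<alpha> (x + y) = \<alpha> x \<circ> \<alpha> y)"

definition strongly_continuous ::
    "('g::topological_space \<Rightarrow> 'a \<Rightarrow> 'a::real_normed_vector) \<Rightarrow> bool" where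
  "strongly_continuous \<alpha> \<longleftrightarrow> (\<forall>a. continuous_on UNIV (\<lambda>x. \<alpha> x a))"

definition ergodic :: "'a::real_vector \<Rightarrow> ('g \<Rightarrow> 'a \<Rightarrow> 'a) \<Rightarrow> bool" where
  "ergodic e \<alpha> \<longleftrightarrow> (\<forall>a. (\<forall>x. \<alpha> x a = a) \<longrightarrow> a \<in> range (\<lambda>r. r *\<^sub>R e))"

definition action_seminorm ::
    "('g::zero \<Rightarrow> real) \<Rightarrow> ('g \<Rightarrow> 'a \<Rightarrow> 'a) \<Rightarrow> 'a::real_normed_vector \<Rightarrow> ennreal" where
  "action_seminorm l \<alpha> a = (SUP x\<in>{x. x \<noteq> 0}. ennreal (norm (\<alpha> x a - a) / l x))"

definition action_domain ::
    "('g::zero \<Rightarrow> real) \<Rightarrow> ('g \<Rightarrow> 'a \<Rightarrow> 'a) \<Rightarrow> 'a::real_normed_vector set" where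
  "action_domain l \<alpha> = {a. action_seminorm l \<alpha> a < \<infinity>}"


section \<open>The dual of a compact group\<close>

text \<open>
  Irreducible representations of compact groups are finite-dimensional, so those in
  the dual are taken to be continuous homomorphisms into invertible complex matrices.
\<close>

definition rep_dim :: "('g::zero \<Rightarrow> complex mat) \<Rightarrow> nat" where
  "rep_dim \<pi> = dim_row (\<pi> 0)"

definition matrix_rep :: "('g::topological_group_add \<Rightarrow> complex mat) \<Rightarrow> bool" where
  "matrix_rep \<pi> \<longleftrightarrow>
     (\<forall>x. \<pi> x \<in> carrier_mat (rep_dim \<pi>) (rep_dim \<pi>)) \<and>
     \<pi> 0 = 1\<^sub>m (rep_dim \<pi>) \<and>
     (\<forall>x y. \<pi> (x + y) = \<pi> x * \<pi> y) \<and>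
     (\<forall>i<rep_dim \<pi>. \<forall>j<rep_dim \<pi>. continuous_on UNIV (\<lambda>x. \<pi> x $$ (i, j)))"

definition invariant_subspace ::
    "('g::topological_group_add \<Rightarrow> complex mat) \<Rightarrow> complex Matrix.vec set \<Rightarrow> bool" where
  "invariant_subspace \<pi> W \<longleftrightarrow>
     W \<subseteq> carrier_vec (rep_dim \<pi>) \<and> 0\<^sub>v (rep_dim \<pi>) \<in> W \<and>
     (\<forall>v\<in>W. \<forall>w\<in>W. v + w \<in> W) \<and> (\<forall>c. \<forall>v\<in>W. c \<cdot>\<^sub>v v \<in> W) \<and>
     (\<forall>x. \<forall>v\<in>W. \<pi> x *\<^sub>v v \<in> W)"

definition irreducible_rep :: "('g::topological_group_add \<Rightarrow> complex mat) \<Rightarrow> bool" where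
  "irreducible_rep \<pi> \<longleftrightarrow>
     matrix_rep \<pi> \<and> rep_dim \<pi> > 0 \<and>
     (\<forall>W. invariant_subspace \<pi> W \<longrightarrow>
        W = {0\<^sub>v (rep_dim \<pi>)} \<or> W = carrier_vec (rep_dim \<pi>))"

definition rep_equiv ::
    "(('g::topological_group_add \<Rightarrow> complex mat) \<times> ('g \<Rightarrow> complex mat)) set" where
  "rep_equiv = {(\<pi>, \<sigma>). irreducible_rep \<pi> \<and> irreducible_rep \<sigma> \<and>
     (\<exists>P Q. \<forall>x. similar_mat_wit (\<pi> x) (\<sigma> x) P Q)}"

lemma equiv_rep_equiv:
  "equiv {\<pi> :: 'g::topological_group_add \<Rightarrow> complex mat. irreducible_rep \<pi>} rep_equiv"
proof (intro equivI)
  show "rep_equiv \<subseteq> {\<pi> :: 'g \<Rightarrow> complex mat. irreducible_rep \<pi>} \<times> {\<pi>. irreducible_rep \<pi>}"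
    by (auto simp: rep_equiv_def)
  show "refl_on {\<pi> :: 'g \<Rightarrow> complex mat. irreducible_rep \<pi>} rep_equiv"
  proof (intro refl_onI)
    fix \<pi> :: "'g \<Rightarrow> complex mat" assume "\<pi> \<in> {\<pi>. irreducible_rep \<pi>}"
    then have "irreducible_rep \<pi>" and "\<forall>x. \<pi> x \<in> carrier_mat (rep_dim \<pi>) (rep_dim \<pi>)"
      by (auto simp: irreducible_rep_def matrix_rep_def)
    then show "(\<pi>, \<pi>) \<in> rep_equiv"
      unfolding rep_equiv_def by (auto intro: similar_mat_wit_refl)
  qed
  show "sym (rep_equiv :: (('g \<Rightarrow> complex mat) \<times> _) set)"
  proof (intro symI)
    fix \<pi> \<sigma> :: "'g \<Rightarrow> complex mat" assume "(\<pi>, \<sigma>) \<in> rep_equiv"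
    then obtain P Q where irr: "irreducible_rep \<pi>" "irreducible_rep \<sigma>"
      and w: "\<And>x. similar_mat_wit (\<pi> x) (\<sigma> x) P Q" by (auto simp: rep_equiv_def)
    have "\<forall>x. similar_mat_wit (\<sigma> x) (\<pi> x) Q P" using similar_mat_wit_sym[OF w] by blast
    with irr show "(\<sigma>, \<pi>) \<in> rep_equiv" unfolding rep_equiv_def by blast
  qed
  show "trans (rep_equiv :: (('g \<Rightarrow> complex mat) \<times> _) set)"
  proof (intro transI)
    fix \<pi> \<sigma> \<tau> :: "'g \<Rightarrow> complex mat"
    assume "(\<pi>, \<sigma>) \<in> rep_equiv" "(\<sigma>, \<tau>) \<in> rep_equiv"
    then obtain P Q P' Q' where irr: "irreducible_rep \<pi>" "irreducible_rep \<tau>"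
      and w: "\<And>x. similar_mat_wit (\<pi> x) (\<sigma> x) P Q"
        "\<And>x. similar_mat_wit (\<sigma> x) (\<tau> x) P' Q'" by (auto simp: rep_equiv_def)
    have "\<forall>x. similar_mat_wit (\<pi> x) (\<tau> x) (P * P') (Q' * Q)"
      using similar_mat_wit_trans[OF w] by blast
    with irr show "(\<pi>, \<tau>) \<in> rep_equiv" unfolding rep_equiv_def by blast
  qed
qed

definition dual_classes :: "('g::topological_group_add \<Rightarrow> complex mat) set set" where
  "dual_classes = {\<pi>. irreducible_rep \<pi>} // rep_equiv"

definition class_dim :: "('g::topological_group_add \<Rightarrow> complex mat) set \<Rightarrow> nat" where
  "class_dim \<gamma> = rep_dim (SOME \<pi>. \<pi> \<in> \<gamma>)"


section \<open>Multiplicities\<close>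

text \<open>
  In the following, \<open>sm\<close> is the scalar multiplication of a complex vector space on which the
  group acts linearly by \<open>\<beta>\<close>. The set \<open>copies sm \<beta> \<gamma>\<close> consists of the invariant subspaces that
  carry a representation in the class \<open>\<gamma>\<close>, given as images of injective intertwiners.
\<close>

definition copies ::
    "(complex \<Rightarrow> 'v \<Rightarrow> 'v) \<Rightarrow> ('g::topological_group_add \<Rightarrow> 'v \<Rightarrow> 'v::ab_group_add) \<Rightarrow>
     ('g \<Rightarrow> complex mat) set \<Rightarrow> 'v set set" where
  "copies sm \<beta> \<gamma> = {W. \<exists>\<pi>\<in>\<gamma>. \<exists>\<phi>.
     (\<forall>v\<in>carrier_vec (rep_dim \<pi>). \<forall>w\<in>carrier_vec (rep_dim \<pi>). \<phi> (v + w) = \<phi> v + \<phi> w) \<and>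
     (\<forall>c. \<forall>v\<in>carrier_vec (rep_dim \<pi>). \<phi> (c \<cdot>\<^sub>v v) = sm c (\<phi> v)) \<and>
     (\<forall>x. \<forall>v\<in>carrier_vec (rep_dim \<pi>). \<phi> (\<pi> x *\<^sub>v v) = \<beta> x (\<phi> v)) \<and>
     bij_betw \<phi> (carrier_vec (rep_dim \<pi>)) W}"

definition isotypic_component ::
    "(complex \<Rightarrow> 'v \<Rightarrow> 'v) \<Rightarrow> ('g::topological_group_add \<Rightarrow> 'v \<Rightarrow> 'v::ab_group_add) \<Rightarrow>
     ('g \<Rightarrow> complex mat) set \<Rightarrow> 'v set" where
  "isotypic_component sm \<beta> \<gamma> = module.span sm (\<Union>(copies sm \<beta> \<gamma>))"

text \<open>
  The isotypic component is a direct sum of copies of \<open>\<gamma>\<close>, so the division below is exact and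
  gives the number of summands.
\<close>

definition rep_multiplicity ::
    "(complex \<Rightarrow> 'v \<Rightarrow> 'v) \<Rightarrow> ('g::topological_group_add \<Rightarrow> 'v \<Rightarrow> 'v::ab_group_add) \<Rightarrow>
     ('g \<Rightarrow> complex mat) set \<Rightarrow> enat" where
  "rep_multiplicity sm \<beta> \<gamma> =
     (let V = isotypic_component sm \<beta> \<gamma> in
      if \<exists>B. finite B \<and> V \<subseteq> module.span sm B
      then enat (vector_space.dim sm V div class_dim \<gamma>) else \<infinity>)"

text \<open>The complexification of \<open>'a\<close> is \<open>'a \<times> 'a\<close>, where \<open>(u, v)\<close> stands for \<open>u \<otimes> 1 + v \<otimes> \<i>\<close>.\<close>

definition cscale :: "complex \<Rightarrow> 'a::real_vector \<times> 'a \<Rightarrow> 'a \<times> 'a" where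
  "cscale c = (\<lambda>(u, v). (Re c *\<^sub>R u - Im c *\<^sub>R v, Re c *\<^sub>R v + Im c *\<^sub>R u))"

lemma vector_space_cscale: "vector_space (cscale :: complex \<Rightarrow> 'a::real_vector \<times> 'a \<Rightarrow> 'a \<times> 'a)"
  by unfold_locales (auto simp: cscale_def algebra_simps)

definition complexify_action :: "('g \<Rightarrow> 'a \<Rightarrow> 'a) \<Rightarrow> 'g \<Rightarrow> 'a \<times> 'a \<Rightarrow> 'a \<times> 'a" where
  "complexify_action \<alpha> x = map_prod (\<alpha> x) (\<alpha> x)"

definition finite_multiplicity ::
    "('g::topological_group_add \<Rightarrow> 'a \<Rightarrow> 'a::real_vector) \<Rightarrow> bool" where
  "finite_multiplicity \<alpha> \<longleftrightarrow>
     (\<forall>\<gamma>\<in>dual_classes. rep_multiplicity cscale (complexify_action \<alpha>) \<gamma> < \<infinity>)"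

end

theory Submission
  imports Defs
begin

text \<open>
  Fix an irreducible matrix representation \<open>\<pi>\<close> of dimension \<open>n\<close> and let \<open>\<phi>\<close> range over the
  intertwiners from \<open>\<pi>\<close> to the complexified action. The isotypic component of the class of \<open>\<pi>\<close> is
  spanned by the values \<open>\<phi> v\<close>, hence by the \<open>n\<close> subspaces \<open>S\<^sub>i = {\<phi> e\<^sub>i | \<phi>}\<close>, where the \<open>e\<^sub>i\<close> are the
  unit vectors. It suffices that every \<open>S\<^sub>i\<close> has finite dimension, and by Riesz' theorem
  (\<open>subspace_finite_spanned_if_ball_partitioned\<close>) that the unit ball of \<open>S\<^sub>i\<close> is totally bounded. Two
  facts combine to give this.
  
  First, the unit ball of \<open>S\<^sub>i\<close> consists of uniformly Lipschitz elements. The map \<open>x \<mapsto> \<pi> x - 1\<close> is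
  almost additive, because \<open>\<pi> (x + y) - 1\<close> differs from the sum of \<open>\<pi> x - 1\<close> and \<open>\<pi> y - 1\<close> only by
  their product. If \<open>\<pi> x - 1\<close> is small but nonzero, its size therefore grows linearly along the
  multiples of \<open>x\<close>, until one of them has left a fixed neighbourhood of the kernel of \<open>\<pi>\<close>. Since \<open>l\<close> is
  subadditive, and bounded below outside that neighbourhood by compactness, \<open>\<pi> x - 1\<close> is \<open>O(l x)\<close>
  (\<open>almost_additive_Lipschitz\<close>, \<open>matrix_rep_Lipschitz\<close>). The vector \<open>e\<^sub>i\<close> is cyclic by
  irreducibility and the action is isometric, so the norm of \<open>\<phi> e\<^sub>i\<close> controls every \<open>\<phi> e\<^sub>j\<close> uniformly
  in \<open>\<phi>\<close> (\<open>cyclic_bound\<close>). Hence \<open>\<alpha> x w - w\<close> is \<open>O(l x \<parallel>w\<parallel>)\<close> on \<open>S\<^sub>i\<close> with one constant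
  (\<open>intertwiner_orbit_Lipschitz\<close>).
  
  Secondly, for a Lip-norm \<open>L\<close> a set on which \<open>L\<close> and the norm are both bounded is totally bounded
  (\<open>Lip_norm_ball_finitely_partitioned\<close>). The state space is weak-* compact by Tychonoff's theorem
  (\<open>compactin_states\<close>), and because \<open>\<rho>\<^sub>L\<close> metrizes that topology it is covered by finitely many small
  \<open>\<rho>\<^sub>L\<close>-balls. An element is then determined up to a small error, uniformly over all states, by its
  values at the finitely many centres. Uniform closeness over the states is closeness in norm, as
  states norm the space by the Hahn-Banach theorem (\<open>norming_state\<close>).
\<close>

section \<open>Sublinear functionals and the Hahn-Banach theorem\<close>

definition sublinear :: "('a::real_vector \<Rightarrow> real) \<Rightarrow> bool" where
  "sublinear p \<longleftrightarrow> (\<forall>x y. p (x + y) \<le> p x + p y) \<and> (\<forall>c\<ge>0. \<forall>x. p (c *\<^sub>R x) \<le> c * p x)"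

lemma sublinear_add: "sublinear p \<Longrightarrow> p (x + y) \<le> p x + p y"
  by (simp add: sublinear_def)

lemma sublinear_zero: "sublinear p \<Longrightarrow> p 0 = 0"
  unfolding sublinear_def by (metis add.right_neutral add_le_cancel_left antisym_conv mult_zero_left order_refl scaleR_zero_left)

lemma sublinear_scale:
  assumes p: "sublinear p" and c: "c \<ge> 0"
  shows "p (c *\<^sub>R x) = c * p x"
proof (cases "c = 0")
  case True
  then show ?thesis using sublinear_zero[OF p] by simp
next
  case False
  have "p ((1 / c) *\<^sub>R (c *\<^sub>R x)) \<le> (1 / c) * p (c *\<^sub>R x)"
    using p c unfolding sublinear_def by (metis divide_nonneg_nonneg zero_le_one)
  then have "c * p x \<le> p (c *\<^sub>R x)" using False c by (simp add: field_simps)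
  moreover have "p (c *\<^sub>R x) \<le> c * p x" using p c unfolding sublinear_def by blast
  ultimately show ?thesis by simp
qed

lemma sublinear_minus: "sublinear p \<Longrightarrow> - p (- x) \<le> p x"
  using sublinear_add[of p x "- x"] sublinear_zero[of p] by simp

text \<open>
  Minimal sublinear functionals turn out to be linear, which reduces the Hahn-Banach theorem to an
  application of Zorn's lemma. The tool for seeing this is an operation that lowers \<open>p\<close> along the
  direction \<open>a\<close> while keeping the value at \<open>a\<close>; it forces
  \<open>tilt p a (- a) \<le> - p a\<close>.
\<close>

definition tilt :: "('a::real_vector \<Rightarrow> real) \<Rightarrow> 'a \<Rightarrow> 'a \<Rightarrow> real" where
  "tilt p a x = (INF t\<in>{0..}. p (x + t *\<^sub>R a) - t * p a)"

lemma tilt_bdd_below: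
  assumes p: "sublinear p"
  shows "bdd_below ((\<lambda>t. p (x + t *\<^sub>R a) - t * p a) ` {0..})"
proof (rule bdd_belowI2[where m = "- p (- x)"])
  fix t :: real assume t: "t \<in> {0..}"
  have "p ((x + t *\<^sub>R a) + - x) \<le> p (x + t *\<^sub>R a) + p (- x)" by (rule sublinear_add[OF p])
  then show "- p (- x) \<le> p (x + t *\<^sub>R a) - t * p a"
    using sublinear_scale[OF p, of t a] t by simp
qed

lemma tilt_le: "sublinear p \<Longrightarrow> t \<ge> 0 \<Longrightarrow> tilt p a x \<le> p (x + t *\<^sub>R a) - t * p a"
  unfolding tilt_def by (rule cINF_lower[OF tilt_bdd_below]) auto

lemma tilt_le_self: "sublinear p \<Longrightarrow> tilt p a x \<le> p x"
  using tilt_le[of p 0 a x] by simp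

lemma sublinear_tilt:
  assumes p: "sublinear p"
  shows "sublinear (tilt p a)"
  unfolding sublinear_def
proof (intro conjI allI impI)
  fix x y
  have "tilt p a (x + y) - (p (y + s *\<^sub>R a) - s * p a) \<le> p (x + t *\<^sub>R a) - t * p a"
    if "s \<ge> 0" "t \<ge> 0" for s t
  proof -
    have "tilt p a (x + y) \<le> p ((x + y) + (s + t) *\<^sub>R a) - (s + t) * p a"
      using that by (intro tilt_le[OF p]) auto
    also have "(x + y) + (s + t) *\<^sub>R a = (x + t *\<^sub>R a) + (y + s *\<^sub>R a)"
      by (simp add: algebra_simps)
    also have "p \<dots> \<le> p (x + t *\<^sub>R a) + p (y + s *\<^sub>R a)" by (rule sublinear_add[OF p])
    finally show ?thesis by (simp add: algebra_simps)
  qed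
  then have "tilt p a (x + y) - (p (y + s *\<^sub>R a) - s * p a) \<le> tilt p a x" if "s \<ge> 0" for s
    unfolding tilt_def[of p a x] using that by (intro cINF_greatest) auto
  then have "tilt p a (x + y) - tilt p a x \<le> p (y + s *\<^sub>R a) - s * p a" if "s \<ge> 0" for s
    using that by (smt (verit))
  then have "tilt p a (x + y) - tilt p a x \<le> tilt p a y"
    unfolding tilt_def[of p a y] by (intro cINF_greatest) auto
  then show "tilt p a (x + y) \<le> tilt p a x + tilt p a y" by simp
next
  fix c :: real and x assume c: "c \<ge> 0"
  show "tilt p a (c *\<^sub>R x) \<le> c * tilt p a x"
  proof (cases "c = 0")
    case True
    then show ?thesis using tilt_le_self[OF p, of a 0] sublinear_zero[OF p] by simp
  next
    case False
    with c have c0: "c > 0" by simp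
    have "tilt p a (c *\<^sub>R x) / c \<le> p (x + t *\<^sub>R a) - t * p a" if t: "t \<ge> 0" for t
    proof -
      have "tilt p a (c *\<^sub>R x) \<le> p (c *\<^sub>R x + (c * t) *\<^sub>R a) - (c * t) * p a"
        using t c by (intro tilt_le[OF p]) auto
      also have "c *\<^sub>R x + (c * t) *\<^sub>R a = c *\<^sub>R (x + t *\<^sub>R a)" by (simp add: algebra_simps)
      also have "p \<dots> = c * p (x + t *\<^sub>R a)" by (rule sublinear_scale[OF p c])
      finally show ?thesis using c0 by (simp add: field_simps)
    qed
    then have "tilt p a (c *\<^sub>R x) / c \<le> tilt p a x"
      unfolding tilt_def[of p a x] by (intro cINF_greatest) auto
    then show ?thesis using c0 by (simp add: field_simps)
  qed
qed

text \<open>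
  Zorn's lemma for the reversed pointwise order: the infimum of a chain is again sublinear because
  two members of a chain are comparable, and it is finite because \<open>- p (- x)\<close> bounds every
  \<open>q x\<close> with \<open>q \<le> p\<close> from below.
\<close>

lemma minimal_sublinear_exists:
  fixes p :: "'a::real_vector \<Rightarrow> real"
  assumes p: "sublinear p"
  obtains f where "sublinear f" "f \<le> p" "\<And>q. sublinear q \<Longrightarrow> q \<le> f \<Longrightarrow> q = f"
proof -
  define S where "S = {q. sublinear q \<and> q \<le> p}"
  have po: "partial_order_on S (relation_of (\<lambda>q r. r \<le> q) S)"
    by (rule partial_order_on_relation_ofI) auto
  have ch: "\<exists>u\<in>S. \<forall>q\<in>C. u \<le> q" if C: "C \<in> Chains (relation_of (\<lambda>q r. r \<le> q) S)" for C
  proof (cases "C = {}")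
    case True
    then show ?thesis using p unfolding S_def by blast
  next
    case False
    have CS: "q \<in> S" if "q \<in> C" for q
      using C that unfolding Chains_def relation_of_def by auto
    have tot: "q \<le> r \<or> r \<le> q" if "q \<in> C" "r \<in> C" for q r
      using C that unfolding Chains_def relation_of_def by auto
    define u where "u x = (INF q\<in>C. q x)" for x
    have bdd: "bdd_below ((\<lambda>q. q x) ` C)" for x
    proof (rule bdd_belowI2[where m = "- p (- x)"])
      fix q assume "q \<in> C"
      then have "sublinear q" "q \<le> p" using CS unfolding S_def by auto
      then have "- q (- x) \<le> q x" "q (- x) \<le> p (- x)"
        using sublinear_minus by (auto simp: le_fun_def)
      then show "- p (- x) \<le> q x" by linarith
    qed
    have u_le: "u x \<le> q x" if "q \<in> C" for q x
      unfolding u_def using bdd that by (intro cINF_lower)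
    have "sublinear u"
      unfolding sublinear_def
    proof (intro conjI allI impI)
      fix x y
      have "u (x + y) - r y \<le> q x" if qr: "q \<in> C" "r \<in> C" for q r
      proof -
        obtain s where s: "s \<in> C" "s \<le> q" "s \<le> r" using tot[OF qr] qr by (metis order_refl)
        have "u (x + y) \<le> s (x + y)" by (rule u_le[OF s(1)])
        also have "\<dots> \<le> s x + s y"
          using CS[OF s(1)] sublinear_add unfolding S_def by blast
        also have "\<dots> \<le> q x + r y" using s by (simp add: add_mono le_fun_def)
        finally show ?thesis by simp
      qed
      then have "u (x + y) - r y \<le> u x" if "r \<in> C" for r
        unfolding u_def[of x] using that False by (intro cINF_greatest) auto
      then have "u (x + y) - u x \<le> r y" if "r \<in> C" for r using that by (smt (verit))
      then have "u (x + y) - u x \<le> u y"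
        unfolding u_def[of y] using False by (intro cINF_greatest) auto
      then show "u (x + y) \<le> u x + u y" by simp
    next
      fix c :: real and x assume c: "c \<ge> 0"
      have le: "u (c *\<^sub>R x) \<le> c * q x" if "q \<in> C" for q
        using u_le[OF that, of "c *\<^sub>R x"] CS[OF that] c sublinear_scale unfolding S_def by fastforce
      show "u (c *\<^sub>R x) \<le> c * u x"
      proof (cases "c = 0")
        case True
        then show ?thesis using le False by auto
      next
        case False
        then have "u (c *\<^sub>R x) / c \<le> q x" if "q \<in> C" for q
          using le[OF that] c by (simp add: field_simps)
        then have "u (c *\<^sub>R x) / c \<le> u x"
          unfolding u_def[of x] using \<open>C \<noteq> {}\<close> by (intro cINF_greatest) auto
        then show ?thesis using c False by (simp add: field_simps)
      qed
    qed
    moreover have "u \<le> p"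
      using u_le CS \<open>C \<noteq> {}\<close> unfolding S_def le_fun_def by (metis (mono_tags, lifting) all_not_in_conv mem_Collect_eq order_trans)
    ultimately show ?thesis using u_le unfolding S_def le_fun_def by blast
  qed
  obtain f where f: "f \<in> S" "\<forall>q\<in>S. q \<le> f \<longrightarrow> q = f"
    using predicate_Zorn[OF po ch] by auto
  show ?thesis
  proof (rule that)
    show "sublinear f" "f \<le> p" using f(1) unfolding S_def by auto
    show "q = f" if "sublinear q" "q \<le> f" for q
      using f that unfolding S_def by (auto intro: order_trans)
  qed
qed

text \<open>
  A minimal \<open>f \<le> tilt p a\<close> equals all of its own tilts. Taking \<open>t = 1\<close> in their definition gives
  \<open>f x \<le> f (x + b) - f b\<close>, so \<open>f\<close> is additive. Starting from the tilted functional rather than from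
  \<open>p\<close> pins down the value at \<open>a\<close>.
\<close>

theorem hahn_banach_supporting:
  assumes p: "sublinear p"
  obtains f where "linear f" "\<And>x. f x \<le> p x" "f a = p a"
proof -
  obtain f where f: "sublinear f" "f \<le> tilt p a" and
    min: "\<And>q. sublinear q \<Longrightarrow> q \<le> f \<Longrightarrow> q = f"
    using minimal_sublinear_exists[OF sublinear_tilt[OF p]] by metis
  have "tilt f b = f" for b
    using min[OF sublinear_tilt[OF f(1)]] tilt_le_self[OF f(1)] by (simp add: le_fun_def)
  then have "f x \<le> f (x + b) - f b" for x b
    using tilt_le[OF f(1), of 1 b x] by simp
  then have add: "f (x + b) = f x + f b" for x b
    using sublinear_add[OF f(1), of x b] by (smt (verit))
  have neg: "f (- x) = - f x" for x
    using add[of x "- x"] sublinear_zero[OF f(1)] by simp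
  have scale: "f (c *\<^sub>R x) = c * f x" for c x
  proof (cases "c \<ge> 0")
    case True
    then show ?thesis by (rule sublinear_scale[OF f(1)])
  next
    case False
    then have "f ((- c) *\<^sub>R x) = - c * f x" by (intro sublinear_scale[OF f(1)]) simp
    then show ?thesis using neg[of "c *\<^sub>R x"] by simp
  qed
  have le: "f x \<le> p x" for x
    using f(2) tilt_le_self[OF p, of a x] by (auto simp: le_fun_def intro: order_trans)
  have "f (- a) \<le> - p a"
    using f(2) tilt_le[OF p, of 1 a "- a"] sublinear_zero[OF p]
    by (auto simp: le_fun_def intro: order_trans)
  then have "f a = p a" using neg le[of a] by simp
  then show ?thesis using that[of f] le add scale by (simp add: linear_iff)
qed

section \<open>Order-unit spaces and their states\<close>

lemma order_unit_bounded: "complete_order_unit_space e \<Longrightarrow> \<exists>r. a \<le> r *\<^sub>R e"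
  unfolding complete_order_unit_space_def order_unit_space_def by blast

lemma order_unit_archimedean:
  "complete_order_unit_space e \<Longrightarrow> (\<And>r. r > 0 \<Longrightarrow> a \<le> r *\<^sub>R e) \<Longrightarrow> a \<le> 0"
  unfolding complete_order_unit_space_def order_unit_space_def by blast

lemma norm_eq_ou_norm: "complete_order_unit_space e \<Longrightarrow> ou_norm e a = norm a"
  unfolding complete_order_unit_space_def by simp

text \<open>
  The infimum of a set of reals that is unbounded below is a default value, which is the same for
  all such sets.
\<close>

lemma Inf_real_unbounded:
  fixes X :: "real set"
  assumes "\<not> bdd_below X"
  shows "Inf X = Inf UNIV"
proof -
  have "\<not> (\<forall>x\<in>uminus ` X. x \<le> z)" for z
    using assms unfolding bdd_below_def by (metis image_eqI minus_le_iff)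
  then have X: "(\<lambda>z. \<forall>x\<in>uminus ` X. x \<le> z) = (\<lambda>z. False)" by (intro ext) simp
  have "\<not> (\<forall>x\<in>uminus ` (UNIV :: real set). x \<le> z)" for z :: real
    by (metis gt_ex not_le surj_uminus UNIV_I)
  then have U: "(\<lambda>z :: real. \<forall>x\<in>uminus ` UNIV. x \<le> z) = (\<lambda>z. False)" by (intro ext) simp
  show ?thesis unfolding Inf_real_def Sup_real_def X U ..
qed

text \<open>
  The order axioms alone do not make the order unit positive: \<open>- 1\<close> satisfies them in the real line.
  That the order-unit formula reproduces the norm excludes this. For an \<open>e\<close> that is not positive,
  \<open>ou_norm\<close> is nonpositive wherever its defining set is nonempty and bounded below, and elsewhere it
  takes one of two default values; yet a norm takes infinitely many positive values on a line.
\<close>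

lemma order_unit_nonneg:
  fixes e :: "'a::{banach, ordered_real_vector}"
  assumes C: "complete_order_unit_space e"
  shows "0 \<le> e"
proof (rule ccontr)
  assume neg: "\<not> 0 \<le> e"
  define X where "X a = {r. - (r *\<^sub>R e) \<le> a \<and> a \<le> r *\<^sub>R e}" for a
  have nonpos: "r \<le> 0" if "r \<in> X a" for r a
  proof (rule ccontr)
    assume "\<not> r \<le> 0"
    have "- (r *\<^sub>R e) \<le> r *\<^sub>R e" using that unfolding X_def by (blast intro: order_trans)
    then have "0 \<le> r *\<^sub>R e + r *\<^sub>R e" by (metis add.commute le_minus_iff minus_le_iff neg_le_iff_le diff_ge_0_iff_ge diff_minus_eq_add)
    then have "0 \<le> (2 * r) *\<^sub>R e" by (metis mult_2 scaleR_left_distrib)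
    then show False using neg \<open>\<not> r \<le> 0\<close> by (auto simp: zero_le_scaleR_iff)
  qed
  \<comment> \<open>The norm of a nonzero vector is positive, so only the two default values are left.\<close>
  have vals: "norm a \<in> {Inf {}, Inf UNIV}" if "a \<noteq> 0" for a :: 'a
  proof -
    have a: "norm a = Inf (X a)" using norm_eq_ou_norm[OF C, of a] unfolding ou_norm_def X_def by simp
    consider "X a = {}" | "\<not> bdd_below (X a)" | r where "r \<in> X a" "bdd_below (X a)" by blast
    then show ?thesis
    proof cases
      case 3
      then have "Inf (X a) \<le> 0" using cInf_lower[OF 3] nonpos[OF 3(1)] by linarith
      then show ?thesis using a that by (metis norm_le_zero_iff)
    qed (use a Inf_real_unbounded in auto)
  qed
  have pos: "norm e > 0" using neg by auto
  \<comment> \<open>Three distinct positive numbers do not fit into a set of two.\<close>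
  have "norm (real k *\<^sub>R e) \<in> {Inf {}, Inf UNIV}" if "k \<noteq> 0" for k
    using neg that by (intro vals) auto
  from this[of 1] this[of 2] this[of 3]
  have "norm e \<in> {Inf {}, Inf UNIV}" "2 * norm e \<in> {Inf {}, Inf UNIV}" "3 * norm e \<in> {Inf {}, Inf UNIV}"
    by simp_all
  then show False using pos by (smt (verit) insertE singletonD)
qed

lemma order_unit_zero_trivial:
  assumes "complete_order_unit_space (0 :: 'a::{banach, ordered_real_vector})"
  shows "(a :: 'a) = 0"
  using order_unit_bounded[OF assms, of a] order_unit_bounded[OF assms, of "- a"] by auto

text \<open>
  The sublinear functional to which the Hahn-Banach theorem is applied. By the archimedean axiom its
  infimum is attained, and the order-unit norm is its symmetrization.
\<close>

definition upper :: "'a::ordered_real_vector \<Rightarrow> 'a \<Rightarrow> real" where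
  "upper e a = Inf {r. a \<le> r *\<^sub>R e}"

lemma scaled_order_unit_le_iff:
  assumes C: "complete_order_unit_space e" and e: "e \<noteq> 0"
  shows "r *\<^sub>R e \<le> s *\<^sub>R e \<longleftrightarrow> r \<le> s"
proof
  assume "r *\<^sub>R e \<le> s *\<^sub>R e"
  show "r \<le> s"
  proof (rule ccontr)
    assume n: "\<not> r \<le> s"
    have "(r - s) *\<^sub>R e \<le> 0" using \<open>r *\<^sub>R e \<le> s *\<^sub>R e\<close> by (simp add: algebra_simps)
    then have "(1 / (r - s)) *\<^sub>R ((r - s) *\<^sub>R e) \<le> (1 / (r - s)) *\<^sub>R 0"
      using n by (intro scaleR_left_mono) auto
    then have "e \<le> 0" using n by simp
    then show False using order_unit_nonneg[OF C] e by simp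
  qed
qed (use order_unit_nonneg[OF C] in \<open>simp add: scaleR_right_mono\<close>)

lemma le_scaled_order_unit_iff:
  assumes C: "complete_order_unit_space e" and e: "e \<noteq> 0"
  shows "a \<le> r *\<^sub>R e \<longleftrightarrow> upper e a \<le> r"
proof -
  obtain s where "- a \<le> s *\<^sub>R e" using order_unit_bounded[OF C] by blast
  then have lower: "(- s) *\<^sub>R e \<le> a" by (simp add: minus_le_iff)
  have bdd: "bdd_below {r. a \<le> r *\<^sub>R e}"
    using lower scaled_order_unit_le_iff[OF C e] unfolding bdd_below_def
    by (metis mem_Collect_eq order_trans)
  have ne: "{r. a \<le> r *\<^sub>R e} \<noteq> {}" using order_unit_bounded[OF C] by blast
  have "a - upper e a *\<^sub>R e \<le> t *\<^sub>R e" if t: "t > 0" for t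
  proof -
    have "upper e a < upper e a + t" using t by simp
    then obtain r where r: "a \<le> r *\<^sub>R e" "r < upper e a + t"
      unfolding upper_def using cInf_lessD[OF ne] by blast
    have "a \<le> (upper e a + t) *\<^sub>R e"
      using r scaled_order_unit_le_iff[OF C e] by (meson less_imp_le order_trans)
    then show ?thesis by (simp add: algebra_simps)
  qed
  then have att: "a \<le> upper e a *\<^sub>R e" using order_unit_archimedean[OF C] by (metis diff_le_0_iff_le)
  show ?thesis
  proof
    show "a \<le> r *\<^sub>R e \<Longrightarrow> upper e a \<le> r" unfolding upper_def by (rule cInf_lower[OF _ bdd]) simp
    show "upper e a \<le> r \<Longrightarrow> a \<le> r *\<^sub>R e"
      using att scaled_order_unit_le_iff[OF C e] by (meson order_trans)
  qed
qed

lemma norm_eq_max_upper: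
  assumes C: "complete_order_unit_space e" and e: "e \<noteq> 0"
  shows "norm a = max (upper e a) (upper e (- a))"
proof -
  have "{r. - (r *\<^sub>R e) \<le> a \<and> a \<le> r *\<^sub>R e} = {max (upper e a) (upper e (- a))..}"
    using le_scaled_order_unit_iff[OF C e] by (auto simp: minus_le_iff)
  then show ?thesis using norm_eq_ou_norm[OF C, of a] by (simp add: ou_norm_def)
qed

lemma sublinear_upper:
  assumes C: "complete_order_unit_space e" and e: "e \<noteq> 0"
  shows "sublinear (upper e)"
proof -
  note iff = le_scaled_order_unit_iff[OF C e]
  have "a \<le> upper e a *\<^sub>R e" for a using iff by blast
  then show ?thesis
    unfolding sublinear_def
    by (metis add_mono iff scaleR_left_distrib scaleR_left_mono scaleR_scaleR)
qed

lemma norm_order_unit: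
  assumes C: "complete_order_unit_space e" and e: "e \<noteq> 0"
  shows "upper e e = 1" "upper e (- e) = - 1" "norm e = 1"
proof -
  have "upper e e \<le> r \<longleftrightarrow> 1 \<le> r" "upper e (- e) \<le> r \<longleftrightarrow> - 1 \<le> r" for r
    using scaled_order_unit_le_iff[OF C e, of 1 r] scaled_order_unit_le_iff[OF C e, of "- 1" r]
    by (simp_all add: le_scaled_order_unit_iff[OF C e])
  then show u: "upper e e = 1" "upper e (- e) = - 1" by (meson order_antisym order_refl)+
  show "norm e = 1" using norm_eq_max_upper[OF C e, of e] u by simp
qed

text \<open>
  As \<open>e\<close> has norm one, a functional with value one at \<open>e\<close> has dual norm one as soon as it is a
  contraction. In this form the conditions on a state are pointwise and closed.
\<close>

lemma states_eq:
  assumes C: "complete_order_unit_space e" and A: "subspace A" "e \<in> A"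
  shows "states A e = {\<mu> \<in> extensional A. (\<forall>a\<in>A. \<forall>b\<in>A. \<mu> (a + b) = \<mu> a + \<mu> b) \<and>
     (\<forall>c. \<forall>a\<in>A. \<mu> (c *\<^sub>R a) = c * \<mu> a) \<and> (\<forall>a\<in>A. \<bar>\<mu> a\<bar> \<le> norm a) \<and> \<mu> e = 1}"
    (is "_ = ?S")
proof
  note nrm = norm_eq_ou_norm[OF C]
  show "states A e \<subseteq> ?S"
  proof
    fix \<mu> assume \<mu>: "\<mu> \<in> states A e"
    then have lin: "\<And>c a. a \<in> A \<Longrightarrow> \<mu> (c *\<^sub>R a) = c * \<mu> a"
      and "\<exists>K. \<forall>a\<in>A. \<bar>\<mu> a\<bar> \<le> K * norm a"
      unfolding states_def ou_dual_def nrm by auto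
    then obtain K where K: "\<And>a. a \<in> A \<Longrightarrow> \<bar>\<mu> a\<bar> \<le> K * norm a" by blast
    have dual: "ou_dual_norm A e \<mu> = 1" using \<mu> unfolding states_def by auto
    have bdd: "bdd_above ((\<lambda>a. \<bar>\<mu> a\<bar>) ` {a \<in> A. norm a \<le> 1})"
    proof (rule bdd_aboveI2[where M = "\<bar>K\<bar>"])
      fix a assume "a \<in> {a \<in> A. norm a \<le> 1}"
      then have "\<bar>\<mu> a\<bar> \<le> K * norm a" "\<bar>K\<bar> * norm a \<le> \<bar>K\<bar> * 1"
        using K mult_left_mono[of "norm a" 1 "\<bar>K\<bar>"] by auto
      moreover have "K * norm a \<le> \<bar>K\<bar> * norm a" by (intro mult_right_mono) auto
      ultimately show "\<bar>\<mu> a\<bar> \<le> \<bar>K\<bar>" by simp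
    qed
    have unit: "\<bar>\<mu> a\<bar> \<le> 1" if "a \<in> A" "norm a \<le> 1" for a
      using cSUP_upper[OF _ bdd, of a] dual that unfolding ou_dual_norm_def nrm by auto
    have "\<bar>\<mu> a\<bar> \<le> norm a" if a: "a \<in> A" for a
    proof (cases "a = 0")
      case True
      then show ?thesis using K[OF a] by simp
    next
      case False
      have "\<bar>\<mu> ((1 / norm a) *\<^sub>R a)\<bar> \<le> 1"
        using False a A(1) by (intro unit) (auto simp: subspace_scale)
      then show ?thesis using False lin[OF a] by (simp add: abs_mult field_simps)
    qed
    then show "\<mu> \<in> ?S" using \<mu> unfolding states_def ou_dual_def by auto
  qed
  show "?S \<subseteq> states A e"
  proof
    fix \<mu> assume \<mu>: "\<mu> \<in> ?S"
    have "\<bar>\<mu> e\<bar> \<le> norm e" "\<mu> e = 1" using \<mu> A(2) by auto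
    then have "e \<noteq> 0" by auto
    then have ne: "norm e = 1" by (rule norm_order_unit(3)[OF C])
    have "(SUP a\<in>{a \<in> A. norm a \<le> 1}. \<bar>\<mu> a\<bar>) = 1"
    proof (rule cSup_eq_maximum)
      show "1 \<in> (\<lambda>a. \<bar>\<mu> a\<bar>) ` {a \<in> A. norm a \<le> 1}"
        using \<open>\<mu> e = 1\<close> ne A(2) by (intro image_eqI[of _ _ e]) auto
      show "x \<le> 1" if "x \<in> (\<lambda>a. \<bar>\<mu> a\<bar>) ` {a \<in> A. norm a \<le> 1}" for x
        using that \<mu> by force
    qed
    moreover have "\<exists>K. \<forall>a\<in>A. \<bar>\<mu> a\<bar> \<le> K * norm a" using \<mu> by (intro exI[of _ 1]) auto
    ultimately show "\<mu> \<in> states A e"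
      using \<mu> unfolding states_def ou_dual_def ou_dual_norm_def nrm by auto
  qed
qed

text \<open>
  The functional supporting \<open>upper e\<close> at \<open>a\<close> or at \<open>- a\<close>, whichever gives the norm, is a
  contraction; from \<open>upper e e = 1\<close> and \<open>upper e (- e) = - 1\<close> it takes the value \<open>1\<close> at \<open>e\<close>. It is
  constructed on the whole space and then restricted to \<open>A\<close>.
\<close>

theorem norming_state:
  assumes C: "complete_order_unit_space e" and A: "subspace A" "e \<in> A" and a: "a \<in> A" "a \<noteq> 0"
  obtains \<mu> where "\<mu> \<in> states A e" "\<bar>\<mu> a\<bar> = norm a"
proof -
  have e: "e \<noteq> 0" using order_unit_zero_trivial C a(2) by blast
  note u = norm_eq_max_upper[OF C e]
  obtain b where b: "b = a \<or> b = - a" "upper e b = norm a"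
    using u[of a] by (metis max_def)
  obtain f where f: "linear f" "\<And>x. f x \<le> upper e x" "f b = upper e b"
    using hahn_banach_supporting[OF sublinear_upper[OF C e]] by metis
  have le: "\<bar>f x\<bar> \<le> norm x" for x
    using f(2)[of x] f(2)[of "- x"] linear_neg[OF f(1), of x] u[of x] by (auto simp: abs_if)
  have "f e = 1"
    using f(2)[of e] f(2)[of "- e"] linear_neg[OF f(1), of e] norm_order_unit[OF C e] by simp
  then have "restrict f A \<in> states A e"
    unfolding states_eq[OF C A] using f(1) le A
    by (auto simp: linear_add linear_scale subspace_add subspace_scale)
  moreover have "\<bar>f a\<bar> = norm a" using b f(3) linear_neg[OF f(1), of a]
    by (metis abs_minus_cancel abs_norm_cancel)
  ultimately show ?thesis using that[of "restrict f A"] a(1) by simp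
qed

text \<open>
  States form a closed subset of a product of compact intervals.
\<close>

theorem compactin_states:
  assumes C: "complete_order_unit_space e" and A: "subspace A" "e \<in> A"
  shows "compactin (product_topology (\<lambda>_. euclideanreal) A) (states A e)"
proof -
  let ?T = "product_topology (\<lambda>_. euclideanreal) A"
  define K where "K = (\<Pi>\<^sub>E a\<in>A. {- norm a..norm a})"
  define Add where "Add = (\<lambda>(a, b). {\<mu> \<in> topspace ?T. \<mu> (a + b) = \<mu> a + \<mu> b})"
  define Scl where "Scl = (\<lambda>(c, a). {\<mu> \<in> topspace ?T. \<mu> (c *\<^sub>R a) = c * \<mu> a})"
  define U where "U = {\<mu> \<in> topspace ?T. \<mu> e = 1}"
  have proj: "continuous_map ?T euclideanreal (\<lambda>\<mu>. \<mu> a)" if "a \<in> A" for a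
    using that by (rule continuous_map_product_projection)
  have eqc: "closedin ?T {\<mu> \<in> topspace ?T. g \<mu> = h \<mu>}"
    if "continuous_map ?T euclideanreal g" "continuous_map ?T euclideanreal h" for g h
    by (rule closedin_continuous_maps_eq[OF _ that]) simp
  have "compactin ?T (\<Inter> (insert K (insert U (Add ` (A \<times> A) \<union> Scl ` (UNIV \<times> A)))))"
  proof (rule closed_compactin_Inter[of _ K])
    show "compactin ?T K" unfolding K_def by (simp add: compactin_PiE)
    fix X assume "X \<in> insert K (insert U (Add ` (A \<times> A) \<union> Scl ` (UNIV \<times> A)))"
    then consider "X = K" | "X = U" | a b where "a \<in> A" "b \<in> A" "X = Add (a, b)"
      | c a where "a \<in> A" "X = Scl (c, a)" by auto
    then show "closedin ?T X"
    proof cases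
      case 1
      then show ?thesis unfolding K_def by (simp add: closedin_product_topology)
    next
      case 2
      show ?thesis unfolding 2 U_def using A(2) by (intro eqc proj continuous_map_const) auto
    next
      case 3
      then show ?thesis unfolding 3 Add_def prod.case using A(1)
        by (intro eqc proj continuous_map_add subspace_add)
    next
      case 4
      then show ?thesis unfolding 4 Scl_def prod.case using A(1)
        by (intro eqc proj continuous_map_real_mult_left subspace_scale)
    qed
  qed simp
  also have "\<Inter> (insert K (insert U (Add ` (A \<times> A) \<union> Scl ` (UNIV \<times> A)))) = states A e"
  proof -
    have regroup: "(X \<and> N) \<and> (X \<and> W) \<and> (\<forall>a\<in>A. \<forall>b\<in>A. X \<and> P a b) \<and> (\<forall>c. \<forall>a\<in>A. X \<and> Q c a)
        \<longleftrightarrow> X \<and> (\<forall>a\<in>A. \<forall>b\<in>A. P a b) \<and> (\<forall>c. \<forall>a\<in>A. Q c a) \<and> N \<and> W"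
      for X N W :: bool and P :: "'a \<Rightarrow> 'a \<Rightarrow> bool" and Q :: "real \<Rightarrow> 'a \<Rightarrow> bool"
      by blast
    have "x \<in> {- c..c} \<longleftrightarrow> \<bar>x\<bar> \<le> c" for x c :: real by auto
    then have k: "\<mu> \<in> K \<longleftrightarrow> \<mu> \<in> extensional A \<and> (\<forall>a\<in>A. \<bar>\<mu> a\<bar> \<le> norm a)" for \<mu>
      unfolding K_def PiE_iff by blast
    have t: "\<mu> \<in> topspace ?T \<longleftrightarrow> \<mu> \<in> extensional A" for \<mu>
      by (simp add: PiE_iff)
    have m: "\<mu> \<in> \<Inter> (insert K (insert U (Add ` (A \<times> A) \<union> Scl ` (UNIV \<times> A)))) \<longleftrightarrow>
        \<mu> \<in> K \<and> \<mu> \<in> U \<and> (\<forall>a\<in>A. \<forall>b\<in>A. \<mu> \<in> Add (a, b)) \<and> (\<forall>c. \<forall>a\<in>A. \<mu> \<in> Scl (c, a))" for \<mu>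
      by (simp only: Inter_insert Int_iff Inter_Un_distrib INT_iff Ball_def mem_Times_iff split_paired_All fst_conv snd_conv UNIV_I) blast
    have "\<mu> \<in> \<Inter> (insert K (insert U (Add ` (A \<times> A) \<union> Scl ` (UNIV \<times> A)))) \<longleftrightarrow>
        \<mu> \<in> extensional A \<and> (\<forall>a\<in>A. \<forall>b\<in>A. \<mu> (a + b) = \<mu> a + \<mu> b) \<and>
        (\<forall>c. \<forall>a\<in>A. \<mu> (c *\<^sub>R a) = c * \<mu> a) \<and> (\<forall>a\<in>A. \<bar>\<mu> a\<bar> \<le> norm a) \<and> \<mu> e = 1" for \<mu>
      unfolding m unfolding k U_def Add_def Scl_def prod.case mem_Collect_eq t by (rule regroup)
    then show ?thesis unfolding states_eq[OF C A] by (intro equalityI subsetI) simp_all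
  qed
  finally show ?thesis .
qed

section \<open>Finite partitions into small pieces\<close>

text \<open>
  Total boundedness, phrased with sets of small diameter in place of balls. Subsets then inherit it
  without any choice of new centres, and a single point of each piece can be taken from whatever
  subset is under consideration.
\<close>

definition finitely_partitioned :: "'a::metric_space set \<Rightarrow> bool" where
  "finitely_partitioned D \<longleftrightarrow> (\<forall>\<epsilon>>0. \<exists>\<P>. finite \<P> \<and> D \<subseteq> \<Union>\<P> \<and> (\<forall>P\<in>\<P>. \<forall>a\<in>P. \<forall>b\<in>P. dist a b < \<epsilon>))"

text \<open>
  The pieces may be given as the fibres of a map with finite range.
\<close>

lemma finitely_partitionedI:
  assumes "\<And>\<epsilon>. \<epsilon> > 0 \<Longrightarrow> \<exists>s :: _ \<Rightarrow> 't. finite (s ` D) \<and> (\<forall>a\<in>D. \<forall>b\<in>D. s a = s b \<longrightarrow> dist a b < \<epsilon>)"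
  shows "finitely_partitioned D"
  unfolding finitely_partitioned_def
proof (intro allI impI)
  fix \<epsilon> :: real assume "\<epsilon> > 0"
  then obtain s :: "_ \<Rightarrow> 't" where s: "finite (s ` D)" "\<forall>a\<in>D. \<forall>b\<in>D. s a = s b \<longrightarrow> dist a b < \<epsilon>"
    using assms by blast
  show "\<exists>\<P>. finite \<P> \<and> D \<subseteq> \<Union>\<P> \<and> (\<forall>P\<in>\<P>. \<forall>a\<in>P. \<forall>b\<in>P. dist a b < \<epsilon>)"
    using s by (intro exI[of _ "(\<lambda>t. {a \<in> D. s a = t}) ` (s ` D)"]) auto
qed

lemma finitely_partitioned_subset: "finitely_partitioned D \<Longrightarrow> D' \<subseteq> D \<Longrightarrow> finitely_partitioned D'"
  unfolding finitely_partitioned_def by (meson subset_trans)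

lemma finitely_partitioned_Times:
  assumes D: "finitely_partitioned D" and E: "finitely_partitioned E"
  shows "finitely_partitioned (D \<times> E)"
  unfolding finitely_partitioned_def
proof (intro allI impI)
  fix \<epsilon> :: real assume \<epsilon>: "\<epsilon> > 0"
  obtain \<P> where P: "finite \<P>" "D \<subseteq> \<Union>\<P>" "\<And>P a b. P \<in> \<P> \<Longrightarrow> a \<in> P \<Longrightarrow> b \<in> P \<Longrightarrow> dist a b < \<epsilon> / 2"
    using D[unfolded finitely_partitioned_def, rule_format, of "\<epsilon> / 2"] \<epsilon> by auto
  obtain \<Q> where Q: "finite \<Q>" "E \<subseteq> \<Union>\<Q>" "\<And>P a b. P \<in> \<Q> \<Longrightarrow> a \<in> P \<Longrightarrow> b \<in> P \<Longrightarrow> dist a b < \<epsilon> / 2"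
    using E[unfolded finitely_partitioned_def, rule_format, of "\<epsilon> / 2"] \<epsilon> by auto
  have small: "dist w z < \<epsilon>" if "P \<in> \<P>" "Q \<in> \<Q>" "w \<in> P \<times> Q" "z \<in> P \<times> Q" for P Q w z
  proof -
    have "dist (fst w) (fst z) < \<epsilon> / 2" "dist (snd w) (snd z) < \<epsilon> / 2"
      using P(3)[OF that(1)] Q(3)[OF that(2)] that(3,4) by (auto simp: mem_Times_iff)
    moreover have "dist w z \<le> dist (fst w) (fst z) + dist (snd w) (snd z)"
      unfolding dist_prod_def by (rule sqrt_sum_squares_le_sum) auto
    ultimately show ?thesis by linarith
  qed
  show "\<exists>\<R>. finite \<R> \<and> D \<times> E \<subseteq> \<Union>\<R> \<and> (\<forall>R\<in>\<R>. \<forall>a\<in>R. \<forall>b\<in>R. dist a b < \<epsilon>)"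
  proof (intro exI conjI)
    let ?R = "(\<lambda>(P, Q). P \<times> Q) ` (\<P> \<times> \<Q>)"
    show "finite ?R" using P(1) Q(1) by simp
    show "D \<times> E \<subseteq> \<Union>?R"
    proof
      fix w assume "w \<in> D \<times> E"
      then obtain P' Q' where "P' \<in> \<P>" "fst w \<in> P'" "Q' \<in> \<Q>" "snd w \<in> Q'"
        using P(2) Q(2) unfolding mem_Times_iff by blast
      then show "w \<in> \<Union>?R" by (intro UnionI[of "P' \<times> Q'"]) (auto simp: mem_Times_iff)
    qed
    show "\<forall>R\<in>?R. \<forall>a\<in>R. \<forall>b\<in>R. dist a b < \<epsilon>" using small by (auto simp only: image_iff mem_Sigma_iff prod.case)
  qed
qed

section \<open>Subspaces with precompact unit ball\<close>

text \<open>
  The coefficient \<open>c\<close> of \<open>f + c *\<^sub>R b\<close> is at most the norm of that vector divided by the distance of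
  \<open>b\<close> from \<open>F\<close>. In a Cauchy sequence of such vectors the coefficients, and with them the components
  in \<open>F\<close>, are therefore Cauchy sequences themselves.
\<close>

lemma complete_plus_line:
  fixes b :: "'a::real_normed_vector"
  assumes F: "subspace F" "complete F"
  shows "complete {f + c *\<^sub>R b |f c. f \<in> F}"
proof (cases "b \<in> F")
  case True
  have "{f + c *\<^sub>R b |f c. f \<in> F} = F"
  proof
    show "{f + c *\<^sub>R b |f c. f \<in> F} \<subseteq> F" using F(1) True by (auto intro: subspace_add subspace_scale)
    show "F \<subseteq> {f + c *\<^sub>R b |f c. f \<in> F}"
    proof
      fix f assume "f \<in> F"
      then show "f \<in> {f + c *\<^sub>R b |f c. f \<in> F}" by (intro CollectI exI[of _ f] exI[of _ 0]) auto
    qed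
  qed
  then show ?thesis using F(2) by simp
next
  case False
  have "closed F" using F(2) by (rule complete_imp_closed)
  then obtain d where d: "d > 0" and "ball b d \<subseteq> - F"
    using False open_contains_ball[of "- F"] by (auto simp: open_Compl)
  then have ball: "d \<le> dist b f" if "f \<in> F" for f
    using that by (force simp: subset_iff not_less)
  have coef: "\<bar>c\<bar> * d \<le> norm (f + c *\<^sub>R b)" if "f \<in> F" for f c
  proof (cases "c = 0")
    case False
    have "d \<le> dist b (- (1 / c) *\<^sub>R f)" using that F(1) by (intro ball) (rule subspace_scale)
    also have "\<dots> = norm ((1 / c) *\<^sub>R (f + c *\<^sub>R b))" using False
      by (simp add: dist_norm algebra_simps)
    also have "\<dots> = norm (f + c *\<^sub>R b) / \<bar>c\<bar>" by simp
    finally show ?thesis using False by (simp add: field_simps)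
  qed simp
  show ?thesis
    unfolding complete_def
  proof (intro allI impI, elim conjE)
    fix s :: "nat \<Rightarrow> 'a" assume s: "\<forall>n. s n \<in> {f + c *\<^sub>R b |f c. f \<in> F}" and cau: "Cauchy s"
    then obtain f c where fF: "\<And>n. f n \<in> F" and sf: "\<And>n. s n = f n + c n *\<^sub>R b"
      by (simp, metis)
    have cdist: "\<bar>c m - c n\<bar> * d \<le> dist (s m) (s n)" for m n
      using coef[of "f m - f n" "c m - c n"] fF F(1)
      by (simp add: sf dist_norm algebra_simps subspace_diff)
    have "Cauchy c"
    proof (rule metric_CauchyI)
      fix \<epsilon> :: real assume "\<epsilon> > 0"
      then obtain N where N: "\<And>m n. m \<ge> N \<Longrightarrow> n \<ge> N \<Longrightarrow> dist (s m) (s n) < \<epsilon> * d"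
        using metric_CauchyD[OF cau, of "\<epsilon> * d"] d by auto
      show "\<exists>N. \<forall>m\<ge>N. \<forall>n\<ge>N. dist (c m) (c n) < \<epsilon>"
        using N cdist d by (metis dist_real_def le_less_trans mult_less_cancel_right_pos)
    qed
    then obtain c0 where c0: "c \<longlonglongrightarrow> c0" using Cauchy_convergent convergent_def by blast
    have cb: "Cauchy (\<lambda>n. c n *\<^sub>R b)"
      using tendsto_scaleR[OF c0 tendsto_const] by (rule LIMSEQ_imp_Cauchy)
    have "Cauchy f"
    proof (rule metric_CauchyI)
      fix \<epsilon> :: real assume \<epsilon>: "\<epsilon> > 0"
      obtain N1 where N1: "\<And>m n. m \<ge> N1 \<Longrightarrow> n \<ge> N1 \<Longrightarrow> dist (s m) (s n) < \<epsilon> / 2"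
        using metric_CauchyD[OF cau, of "\<epsilon> / 2"] \<epsilon> by auto
      obtain N2 where N2: "\<And>m n. m \<ge> N2 \<Longrightarrow> n \<ge> N2 \<Longrightarrow> dist (c m *\<^sub>R b) (c n *\<^sub>R b) < \<epsilon> / 2"
        using metric_CauchyD[OF cb, of "\<epsilon> / 2"] \<epsilon> by auto
      have "dist (f m) (f n) < \<epsilon>" if "m \<ge> max N1 N2" "n \<ge> max N1 N2" for m n
      proof -
        have "f m - f n = (s m - s n) - (c m *\<^sub>R b - c n *\<^sub>R b)" by (simp add: sf)
        then have "dist (f m) (f n) \<le> dist (s m) (s n) + dist (c m *\<^sub>R b) (c n *\<^sub>R b)"
          unfolding dist_norm by (metis norm_triangle_ineq4)
        then show ?thesis using N1[of m n] N2[of m n] that by simp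
      qed
      then show "\<exists>N. \<forall>m\<ge>N. \<forall>n\<ge>N. dist (f m) (f n) < \<epsilon>" by blast
    qed
    then obtain f0 where f0: "f0 \<in> F" "f \<longlonglongrightarrow> f0"
      using F(2)[unfolded complete_def, rule_format, of f] fF by blast
    have "s \<longlonglongrightarrow> f0 + c0 *\<^sub>R b"
      unfolding sf[abs_def] using f0 c0 by (intro tendsto_intros)
    then show "\<exists>l\<in>{f + c *\<^sub>R b |f c. f \<in> F}. s \<longlonglongrightarrow> l" using f0 by blast
  qed
qed

lemma closed_span_finite:
  fixes B :: "'a::real_normed_vector set"
  assumes "finite B"
  shows "closed (span B)"
proof -
  have "complete (span B)"
    using assms
  proof (induction B rule: finite_induct)
    case empty
    then show ?case by (simp add: compact_imp_complete)
  next
    case (insert b B)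
    have "span (insert b B) = {f + c *\<^sub>R b |f c. f \<in> span B}"
    proof (intro equalityI subsetI)
      fix x assume "x \<in> span (insert b B)"
      then obtain k where "x - k *\<^sub>R b \<in> span B" by (auto simp: span_insert)
      then show "x \<in> {f + c *\<^sub>R b |f c. f \<in> span B}"
        by (intro CollectI exI[of _ "x - k *\<^sub>R b"] exI[of _ k]) simp
    next
      fix x assume "x \<in> {f + c *\<^sub>R b |f c. f \<in> span B}"
      then obtain f c where "x = f + c *\<^sub>R b" "f \<in> span B" by blast
      then show "x \<in> span (insert b B)" unfolding span_insert by (intro CollectI exI[of _ c]) simp
    qed
    then show ?case using complete_plus_line[OF subspace_span insert.IH] by simp
  qed
  then show ?thesis by (rule complete_imp_closed)
qed

text \<open>
  Riesz' theorem. Finitely many \<open>b \<in> S\<close> approximate the unit ball of \<open>S\<close> up to \<open>1/2\<close>. Replacing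
  \<open>w \<in> S\<close> by its error of approximation halves the norm and stays within \<open>S\<close>, so iteration puts \<open>w\<close>
  into the closure of the span of the \<open>b\<close>; but that span is closed.
\<close>

theorem subspace_finite_spanned_if_ball_partitioned:
  fixes S :: "'a::real_normed_vector set"
  assumes S: "subspace S" and D: "finitely_partitioned {w \<in> S. norm w \<le> 1}"
  obtains B where "finite B" "B \<subseteq> S" "S \<subseteq> span B"
proof -
  let ?D = "{w \<in> S. norm w \<le> 1}"
  obtain \<P> where P: "finite \<P>" "?D \<subseteq> \<Union>\<P>" "\<And>P a b. P \<in> \<P> \<Longrightarrow> a \<in> P \<Longrightarrow> b \<in> P \<Longrightarrow> dist a b < 1/2"
    using D[unfolded finitely_partitioned_def, rule_format, of "1/2"] by auto
  \<comment> \<open>The centres are chosen inside \<open>S\<close>, for otherwise the errors of approximation would leave \<open>S\<close>.\<close>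
  define B where "B = (\<lambda>P. SOME b. b \<in> P \<inter> ?D) ` {P \<in> \<P>. P \<inter> ?D \<noteq> {}}"
  have finB: "finite B" unfolding B_def using P(1) by simp
  have some: "(SOME b. b \<in> P \<inter> ?D) \<in> P \<inter> ?D" if "P \<inter> ?D \<noteq> {}" for P
    using that by (meson ex_in_conv someI_ex)
  have BS: "B \<subseteq> S" unfolding B_def using some by blast
  have near: "\<exists>b\<in>B. dist w b < 1/2" if w: "w \<in> ?D" for w
  proof -
    obtain P' where P': "P' \<in> \<P>" "w \<in> P'" using P(2) w by blast
    then have "(SOME b. b \<in> P' \<inter> ?D) \<in> B" unfolding B_def using w by blast
    moreover have "dist w (SOME b. b \<in> P' \<inter> ?D) < 1/2"
      using P(3)[OF P'] some[of P'] w P' by blast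
    ultimately show ?thesis by blast
  qed
  have BspanS: "span B \<subseteq> S" using BS S by (simp add: span_minimal)
  have halve: "\<exists>f\<in>span B. norm (w - f) \<le> norm w / 2" if w: "w \<in> S" for w
  proof (cases "w = 0")
    case True
    then show ?thesis using span_zero by (intro bexI[of _ 0]) auto
  next
    case False
    have "(1 / norm w) *\<^sub>R w \<in> ?D" using S w False by (simp add: subspace_scale)
    then obtain b where b: "b \<in> B" "dist ((1 / norm w) *\<^sub>R w) b < 1/2" using near by blast
    have "w - norm w *\<^sub>R b = norm w *\<^sub>R ((1 / norm w) *\<^sub>R w - b)"
      using False by (simp add: algebra_simps)
    then have "norm (w - norm w *\<^sub>R b) = norm w * dist ((1 / norm w) *\<^sub>R w) b"
      by (simp add: dist_norm)
    also have "\<dots> \<le> norm w * (1/2)" using b(2) by (intro mult_left_mono) auto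
    finally show ?thesis using b(1) by (intro bexI[of _ "norm w *\<^sub>R b"]) (auto intro: span_scale span_base)
  qed
  have approx: "\<exists>f\<in>span B. norm (w - f) \<le> norm w / 2 ^ k" if w: "w \<in> S" for w k
  proof (induction k)
    case 0
    then show ?case using span_zero by (intro bexI[of _ 0]) auto
  next
    case (Suc k)
    then obtain f where f: "f \<in> span B" "norm (w - f) \<le> norm w / 2 ^ k" by blast
    then have "w - f \<in> S" using w BspanS S by (blast intro: subspace_diff)
    then obtain g where g: "g \<in> span B" "norm ((w - f) - g) \<le> norm (w - f) / 2" using halve by blast
    have "norm (w - (f + g)) \<le> norm (w - f) / 2" using g(2) by (simp add: diff_diff_eq)
    also have "\<dots> \<le> norm w / 2 ^ k / 2" using f(2) by (rule divide_right_mono) simp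
    finally have "norm (w - (f + g)) \<le> norm w / 2 ^ Suc k" by (simp add: mult.commute)
    then show ?case using f g span_add by blast
  qed
  have "S \<subseteq> span B"
  proof
    fix w assume w: "w \<in> S"
    have "w \<in> closure (span B)"
      unfolding closure_approachable
    proof (intro allI impI)
      fix \<epsilon> :: real assume \<epsilon>: "\<epsilon> > 0"
      obtain k where "norm w / \<epsilon> < 2 ^ k" using real_arch_pow[of 2] by auto
      then have "norm w / 2 ^ k < \<epsilon>" using \<epsilon> by (simp add: field_simps)
      then show "\<exists>f\<in>span B. dist f w < \<epsilon>"
        using approx[OF w, of k] by (metis dist_norm dist_commute le_less_trans)
    qed
    then show "w \<in> span B" using closed_span_finite[OF finB] by simp
  qed
  then show ?thesis using that finB BS by blast
qed

section \<open>Balls of a Lip-norm\<close>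

lemma rho_triangle: "rho A L \<mu> \<kappa> \<le> rho A L \<mu> \<nu> + rho A L \<nu> \<kappa>"
  unfolding rho_def[of A L \<mu> \<kappa>]
proof (rule SUP_least)
  fix a assume a: "a \<in> {a \<in> A. L a \<le> 1}"
  have "ennreal \<bar>\<mu> a - \<kappa> a\<bar> \<le> ennreal (\<bar>\<mu> a - \<nu> a\<bar> + \<bar>\<nu> a - \<kappa> a\<bar>)"
    by (rule ennreal_leI) simp
  also have "\<dots> = ennreal \<bar>\<mu> a - \<nu> a\<bar> + ennreal \<bar>\<nu> a - \<kappa> a\<bar>" by (simp add: ennreal_plus)
  also have "\<dots> \<le> rho A L \<mu> \<nu> + rho A L \<nu> \<kappa>"
    unfolding rho_def using a by (intro add_mono SUP_upper)
  finally show "ennreal \<bar>\<mu> a - \<kappa> a\<bar> \<le> rho A L \<mu> \<nu> + rho A L \<nu> \<kappa>" .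
qed

text \<open>
  This is where the agreement of the two topologies becomes usable: a \<open>rho\<close>-ball is open for the
  weak-* topology and can take part in a finite subcover.
\<close>

lemma openin_rho_ball:
  "openin (rho_topology A e L) {\<nu> \<in> states A e. rho A L \<mu> \<nu> < ennreal r}"
  unfolding openin_rho_topology
proof (intro conjI ballI)
  fix \<nu> assume "\<nu> \<in> {\<nu> \<in> states A e. rho A L \<mu> \<nu> < ennreal r}"
  then have lt: "rho A L \<mu> \<nu> < ennreal r" by simp
  then obtain t where t: "rho A L \<mu> \<nu> = ennreal t" "t \<ge> 0"
    by (metis ennreal_cases ennreal_less_top order_less_imp_not_less infinity_ennreal_def)
  then have "t < r" using lt by (simp add: ennreal_less_iff)
  have "rho A L \<mu> \<kappa> < ennreal r" if "rho A L \<nu> \<kappa> < ennreal (r - t)" for \<kappa>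
  proof -
    have "rho A L \<mu> \<kappa> \<le> ennreal t + rho A L \<nu> \<kappa>" using rho_triangle t(1) by metis
    also have "\<dots> < ennreal t + ennreal (r - t)" using that by (simp add: ennreal_add_left_cancel_less)
    also have "\<dots> = ennreal r" using t(2) \<open>t < r\<close> by (simp flip: ennreal_plus)
    finally show ?thesis .
  qed
  then show "\<exists>s>0. \<forall>\<kappa>\<in>states A e. rho A L \<nu> \<kappa> < ennreal s
      \<longrightarrow> \<kappa> \<in> {\<nu> \<in> states A e. rho A L \<mu> \<nu> < ennreal r}"
    using \<open>t < r\<close> by (intro exI[of _ "r - t"]) auto
qed blast

text \<open>
  The state space is covered by finitely many \<open>rho\<close>-balls with centres \<open>F\<close>. An element \<open>a\<close> of the set
  is classified by its values at the states in \<open>F\<close>, rounded to multiples of \<open>\<delta>\<close>; these are bounded by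
  \<open>R\<close>, so there are finitely many classes. Each further state is \<open>rho\<close>-close to some \<open>\<mu> \<in> F\<close>, and
  \<open>L\<close> being bounded by \<open>K\<close>, it nearly agrees with \<open>\<mu>\<close> on the set.
\<close>

theorem Lip_norm_ball_finitely_partitioned:
  assumes C: "complete_order_unit_space e" and A: "subspace A" "e \<in> A"
    and Lip: "Lip_norm A e L" and K: "K > 0"
  shows "finitely_partitioned {a \<in> A. L a \<le> K \<and> norm a \<le> R}"
proof (rule finitely_partitionedI)
  fix \<epsilon> :: real assume \<epsilon>: "\<epsilon> > 0"
  let ?D = "{a \<in> A. L a \<le> K \<and> norm a \<le> R}"
  \<comment> \<open>Moving from a state to the nearest centre costs \<open>K * r = \<epsilon> / 8\<close> for each of two elements, and the
    rounding costs \<open>\<delta> = \<epsilon> / 4\<close>, which adds up to less than \<open>\<epsilon>\<close>.\<close>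
  define r where "r = \<epsilon> / (8 * K)"
  have r: "r > 0" using \<epsilon> K unfolding r_def by simp
  define ball where "ball \<mu> = {\<nu> \<in> states A e. rho A L \<mu> \<nu> < ennreal r}" for \<mu>
  have top: "rho_topology A e L = weak_star_states A e" and sn: "seminorm_on A L"
    using Lip unfolding Lip_norm_def by auto
  have compact: "compact_space (weak_star_states A e)"
    unfolding weak_star_states_def by (rule compact_space_subtopology[OF compactin_states[OF C A]])
  have space: "topspace (weak_star_states A e) = states A e"
    unfolding weak_star_states_def topspace_subtopology
    using compactin_subset_topspace[OF compactin_states[OF C A]] by blast
  have self: "\<mu> \<in> ball \<mu>" if "\<mu> \<in> states A e" for \<mu>
    unfolding ball_def rho_def using that r by (simp add: SUP_constant bot_ennreal)
  have "\<exists>\<F>. finite \<F> \<and> \<F> \<subseteq> ball ` states A e \<and> topspace (weak_star_states A e) \<subseteq> \<Union>\<F>"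
    using compact unfolding compact_space_alt
  proof (elim allE impE)
    show "(\<forall>U\<in>ball ` states A e. openin (weak_star_states A e) U) \<and>
        topspace (weak_star_states A e) \<subseteq> \<Union> (ball ` states A e)"
      using openin_rho_ball[of A e L _ r] self unfolding space ball_def top by auto
  qed
  then obtain F where F: "finite F" "F \<subseteq> states A e" "states A e \<subseteq> (\<Union>\<mu>\<in>F. ball \<mu>)"
    unfolding space by (metis finite_subset_image)
  define \<delta> where "\<delta> = \<epsilon> / 4"
  have \<delta>: "\<delta> > 0" using \<epsilon> unfolding \<delta>_def by simp
  define s where "s a = (\<lambda>\<mu>\<in>F. \<lfloor>\<mu> a / \<delta>\<rfloor>)" for a
  have st: "\<bar>\<mu> a\<bar> \<le> norm a" "\<mu> (a - b) = \<mu> a - \<mu> b"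
    if "\<mu> \<in> states A e" "a \<in> A" "b \<in> A" for \<mu> a b
  proof -
    note S = that(1)[unfolded states_eq[OF C A], simplified]
    show "\<bar>\<mu> a\<bar> \<le> norm a" using S that(2) by blast
    have "\<mu> ((a - b) + b) = \<mu> (a - b) + \<mu> b" using S that A(1) subspace_diff by blast
    then show "\<mu> (a - b) = \<mu> a - \<mu> b" by simp
  qed
  have "finite (s ` ?D)"
  proof (rule finite_subset)
    show "s ` ?D \<subseteq> (\<Pi>\<^sub>E \<mu>\<in>F. {\<lfloor>- R / \<delta>\<rfloor>..\<lfloor>R / \<delta>\<rfloor>})"
    proof (intro image_subsetI PiE_I)
      fix a \<mu> assume a: "a \<in> ?D" and \<mu>: "\<mu> \<in> F"
      have "\<bar>\<mu> a\<bar> \<le> R" using st(1)[of \<mu> a a] a \<mu> F(2) by force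
      then have "- R \<le> \<mu> a" "\<mu> a \<le> R" by auto
      then have "- R / \<delta> \<le> \<mu> a / \<delta>" "\<mu> a / \<delta> \<le> R / \<delta>" using \<delta> by (simp_all only: divide_right_mono less_imp_le)
      then show "s a \<mu> \<in> {\<lfloor>- R / \<delta>\<rfloor>..\<lfloor>R / \<delta>\<rfloor>}" using \<mu> unfolding s_def by (simp add: floor_mono)
    qed (simp add: s_def)
    show "finite (\<Pi>\<^sub>E \<mu>\<in>F. {\<lfloor>- R / \<delta>\<rfloor>..\<lfloor>R / \<delta>\<rfloor>})" using F(1) by (intro finite_PiE) auto
  qed
  moreover have "dist a b < \<epsilon>" if ab: "a \<in> ?D" "b \<in> ?D" and eq: "s a = s b" for a b
  proof (cases "a = b")
    case True
    then show ?thesis using \<epsilon> by simp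
  next
    case False
    have abA: "a \<in> A" "b \<in> A" using ab by auto
    then obtain \<nu> where \<nu>: "\<nu> \<in> states A e" "\<bar>\<nu> (a - b)\<bar> = norm (a - b)"
      using norming_state[OF C A subspace_diff[OF A(1) abA]] False by (metis right_minus_eq)
    obtain \<mu> where \<mu>: "\<mu> \<in> F" "\<nu> \<in> ball \<mu>" using F(3) \<nu>(1) by blast
    have \<mu>S: "\<mu> \<in> states A e" using \<mu>(1) F(2) by blast
    have near: "\<bar>\<mu> c - \<nu> c\<bar> < \<epsilon> / 8" if c: "c \<in> ?D" for c
    proof -
      have cA: "c \<in> A" using c by simp
      have "L ((1 / K) *\<^sub>R c) = (1 / K) * L c"
        using sn cA K unfolding seminorm_on_def by simp
      also have "\<dots> \<le> 1" using c K by (simp add: field_simps)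
      finally have "(1 / K) *\<^sub>R c \<in> {a \<in> A. L a \<le> 1}" using cA A(1) by (simp add: subspace_scale)
      then have "ennreal \<bar>\<mu> ((1 / K) *\<^sub>R c) - \<nu> ((1 / K) *\<^sub>R c)\<bar> \<le> rho A L \<mu> \<nu>"
        unfolding rho_def by (rule SUP_upper)
      also have "\<dots> < ennreal r" using \<mu>(2) unfolding ball_def by simp
      finally have "\<bar>\<mu> ((1 / K) *\<^sub>R c) - \<nu> ((1 / K) *\<^sub>R c)\<bar> < r" by (simp add: ennreal_less_iff)
      moreover have "\<mu> ((1 / K) *\<^sub>R c) = (1 / K) * \<mu> c" "\<nu> ((1 / K) *\<^sub>R c) = (1 / K) * \<nu> c"
        using \<mu>S \<nu>(1) cA unfolding states_eq[OF C A] by blast+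
      ultimately have "(1 / K) * \<bar>\<mu> c - \<nu> c\<bar> < r"
        using K by (simp add: abs_mult flip: right_diff_distrib diff_divide_distrib)
      then show ?thesis using K unfolding r_def by (simp add: field_simps)
    qed
    have "\<lfloor>\<mu> a / \<delta>\<rfloor> = \<lfloor>\<mu> b / \<delta>\<rfloor>" using fun_cong[OF eq, of \<mu>] \<mu>(1) unfolding s_def by simp
    then have "\<bar>\<mu> a / \<delta> - \<mu> b / \<delta>\<bar> < 1" by linarith
    then have "\<bar>\<mu> a - \<mu> b\<bar> / \<delta> < 1"
      using \<delta> by (simp add: diff_divide_distrib[symmetric])
    then have "\<bar>\<mu> a - \<mu> b\<bar> < \<epsilon> / 4" using \<delta> unfolding \<delta>_def by (simp add: pos_divide_less_eq)
    then have "\<bar>\<nu> a - \<nu> b\<bar> < \<epsilon>" using near[OF ab(1)] near[OF ab(2)] by linarith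
    then show ?thesis using \<nu> st(2)[OF \<nu>(1) abA] by (simp add: dist_norm)
  qed
  ultimately show "\<exists>s :: 'a \<Rightarrow> ('a \<Rightarrow> real) \<Rightarrow> int. finite (s ` ?D) \<and>
      (\<forall>a\<in>?D. \<forall>b\<in>?D. s a = s b \<longrightarrow> dist a b < \<epsilon>)" by blast
qed

section \<open>Lipschitz elements of an action\<close>

lemma length_function_nonneg:
  assumes l: "length_function l"
  shows "l x \<ge> 0"
proof -
  have "l (x + - x) \<le> l x + l (- x)" "l (- x) = l x" "l 0 = 0"
    using l unfolding length_function_def by blast+
  then show ?thesis by simp
qed

lemma length_function_pos:
  assumes l: "length_function l" and x: "x \<noteq> 0"
  shows "l x > 0"
proof -
  have "l x \<noteq> 0" using l x unfolding length_function_def by blast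
  then show ?thesis using length_function_nonneg[OF l, of x] by simp
qed

text \<open>
  Order automorphisms that fix \<open>e\<close> preserve the order-unit norm, since it is defined by the order
  and \<open>e\<close> alone.
\<close>

lemma ou_action_isometric:
  assumes C: "complete_order_unit_space e" and \<alpha>: "ou_action e \<alpha>"
  shows "norm (\<alpha> x a) = norm a"
proof -
  have f: "linear (\<alpha> x)" "\<And>a b. \<alpha> x a \<le> \<alpha> x b \<longleftrightarrow> a \<le> b" "\<alpha> x e = e"
    using \<alpha> unfolding ou_action_def ou_automorphism_def by auto
  have "\<alpha> x (r *\<^sub>R e) = r *\<^sub>R e" "\<alpha> x (- (r *\<^sub>R e)) = - (r *\<^sub>R e)" for r
    using f(1,3) by (simp_all add: linear_scale linear_neg)
  then have "- (r *\<^sub>R e) \<le> \<alpha> x a \<longleftrightarrow> - (r *\<^sub>R e) \<le> a" "\<alpha> x a \<le> r *\<^sub>R e \<longleftrightarrow> a \<le> r *\<^sub>R e" for r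
    using f(2) by metis+
  then show ?thesis unfolding norm_eq_ou_norm[OF C, symmetric] ou_norm_def by simp
qed

lemma action_seminorm_le_iff:
  assumes l: "length_function l" and \<alpha>: "\<alpha> 0 = id" and K: "K \<ge> 0"
  shows "action_seminorm l \<alpha> a \<le> ennreal K \<longleftrightarrow> (\<forall>x. norm (\<alpha> x a - a) \<le> K * l x)"
proof -
  have pos: "l x > 0" if "x \<noteq> 0" for x by (rule length_function_pos[OF l that])
  have l0: "l 0 = 0" using l unfolding length_function_def by blast
  have "action_seminorm l \<alpha> a \<le> ennreal K \<longleftrightarrow> (\<forall>x. x \<noteq> 0 \<longrightarrow> norm (\<alpha> x a - a) / l x \<le> K)"
    unfolding action_seminorm_def SUP_le_iff using K by (simp add: ennreal_le_iff)
  also have "\<dots> \<longleftrightarrow> (\<forall>x. x \<noteq> 0 \<longrightarrow> norm (\<alpha> x a - a) \<le> K * l x)"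
    using pos by (simp add: pos_divide_le_eq)
  also have "\<dots> \<longleftrightarrow> (\<forall>x. norm (\<alpha> x a - a) \<le> K * l x)"
  proof (intro iffI allI)
    fix x assume "\<forall>x. x \<noteq> 0 \<longrightarrow> norm (\<alpha> x a - a) \<le> K * l x"
    then show "norm (\<alpha> x a - a) \<le> K * l x" using \<alpha> l0 by (cases "x = 0") auto
  qed blast
  finally show ?thesis .
qed

lemma mem_action_domain_iff:
  assumes l: "length_function l" and \<alpha>: "\<alpha> 0 = id"
  shows "a \<in> action_domain l \<alpha> \<longleftrightarrow> (\<exists>K\<ge>0. \<forall>x. norm (\<alpha> x a - a) \<le> K * l x)"
proof
  assume "a \<in> action_domain l \<alpha>"
  then obtain K where "K \<ge> 0" "action_seminorm l \<alpha> a = ennreal K"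
    unfolding action_domain_def by (cases "action_seminorm l \<alpha> a") auto
  then show "\<exists>K\<ge>0. \<forall>x. norm (\<alpha> x a - a) \<le> K * l x"
    using action_seminorm_le_iff[of l \<alpha> K a, OF l \<alpha>] by auto
next
  assume "\<exists>K\<ge>0. \<forall>x. norm (\<alpha> x a - a) \<le> K * l x"
  then obtain K where "action_seminorm l \<alpha> a \<le> ennreal K"
    using action_seminorm_le_iff[of l \<alpha> _ a, OF l \<alpha>] by blast
  then show "a \<in> action_domain l \<alpha>"
    unfolding action_domain_def by (auto intro: le_less_trans)
qed

lemma subspace_action_domain:
  assumes l: "length_function l" and \<alpha>: "ou_action e \<alpha>"
  shows "subspace (action_domain l \<alpha>)" "e \<in> action_domain l \<alpha>"
proof -
  have \<alpha>0: "\<alpha> 0 = id" and lin: "linear (\<alpha> x)" and e: "\<alpha> x e = e" for x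
    using \<alpha> unfolding ou_action_def ou_automorphism_def by auto
  note iff = mem_action_domain_iff[of l \<alpha>, OF l \<alpha>0]
  show "e \<in> action_domain l \<alpha>" unfolding iff using e by (intro exI[of _ 0]) auto
  show "subspace (action_domain l \<alpha>)"
  proof (rule subspaceI)
    show "0 \<in> action_domain l \<alpha>"
      unfolding iff using lin by (intro exI[of _ 0]) (auto simp: linear_0)
  next
    fix a b assume "a \<in> action_domain l \<alpha>" "b \<in> action_domain l \<alpha>"
    then obtain K M where K: "K \<ge> 0" "\<And>x. norm (\<alpha> x a - a) \<le> K * l x"
      and M: "M \<ge> 0" "\<And>x. norm (\<alpha> x b - b) \<le> M * l x" unfolding iff by blast
    have "norm (\<alpha> x (a + b) - (a + b)) \<le> (K + M) * l x" for x
    proof -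
      have "\<alpha> x (a + b) - (a + b) = (\<alpha> x a - a) + (\<alpha> x b - b)"
        using lin[of x] by (simp add: linear_add)
      then have "norm (\<alpha> x (a + b) - (a + b)) \<le> norm (\<alpha> x a - a) + norm (\<alpha> x b - b)"
        by (metis norm_triangle_ineq)
      then show ?thesis using K(2)[of x] M(2)[of x] by (simp add: distrib_right)
    qed
    then show "a + b \<in> action_domain l \<alpha>"
      unfolding iff using K(1) M(1) by (intro exI[of _ "K + M"]) auto
  next
    fix c :: real and a assume "a \<in> action_domain l \<alpha>"
    then obtain K where K: "K \<ge> 0" "\<And>x. norm (\<alpha> x a - a) \<le> K * l x" unfolding iff by blast
    have "norm (\<alpha> x (c *\<^sub>R a) - c *\<^sub>R a) \<le> (\<bar>c\<bar> * K) * l x" for x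
    proof -
      have "\<alpha> x (c *\<^sub>R a) - c *\<^sub>R a = c *\<^sub>R (\<alpha> x a - a)"
        using lin[of x] by (simp add: linear_scale scaleR_diff_right)
      then have "norm (\<alpha> x (c *\<^sub>R a) - c *\<^sub>R a) = \<bar>c\<bar> * norm (\<alpha> x a - a)" by simp
      also have "\<dots> \<le> \<bar>c\<bar> * (K * l x)" using K(2) by (rule mult_left_mono) simp
      finally show ?thesis by (simp add: mult.assoc)
    qed
    then show "c *\<^sub>R a \<in> action_domain l \<alpha>"
      unfolding iff using K(1) by (intro exI[of _ "\<bar>c\<bar> * K"]) auto
  qed
qed

text \<open>
  The bound \<open>K * l x\<close> places these elements into the domain of the seminorm and bounds their
  Lip-norm by \<open>K\<close>.
\<close>

theorem Lipschitz_ball_finitely_partitioned: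
  assumes l: "length_function l" and C: "complete_order_unit_space e" and \<alpha>: "ou_action e \<alpha>"
    and Lip: "Lip_norm (action_domain l \<alpha>) e (\<lambda>a. enn2real (action_seminorm l \<alpha> a))"
    and K: "K > 0"
  shows "finitely_partitioned {a. (\<forall>x. norm (\<alpha> x a - a) \<le> K * l x) \<and> norm a \<le> R}"
proof (rule finitely_partitioned_subset)
  show "finitely_partitioned
      {a \<in> action_domain l \<alpha>. enn2real (action_seminorm l \<alpha> a) \<le> K \<and> norm a \<le> R}"
    using Lip_norm_ball_finitely_partitioned[OF C subspace_action_domain[OF l \<alpha>] Lip K] .
  have \<alpha>0: "\<alpha> 0 = id" using \<alpha> unfolding ou_action_def by blast
  show "{a. (\<forall>x. norm (\<alpha> x a - a) \<le> K * l x) \<and> norm a \<le> R}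
      \<subseteq> {a \<in> action_domain l \<alpha>. enn2real (action_seminorm l \<alpha> a) \<le> K \<and> norm a \<le> R}"
  proof
    fix a assume a: "a \<in> {a. (\<forall>x. norm (\<alpha> x a - a) \<le> K * l x) \<and> norm a \<le> R}"
    then have "action_seminorm l \<alpha> a \<le> ennreal K"
      using action_seminorm_le_iff[of l \<alpha> K a, OF l \<alpha>0] K by simp
    then have "enn2real (action_seminorm l \<alpha> a) \<le> K"
      using K by (simp add: enn2real_leI)
    moreover have "a \<in> action_domain l \<alpha>"
      using a K unfolding mem_action_domain_iff[of l \<alpha>, OF l \<alpha>0] by (intro exI[of _ K]) auto
    ultimately show "a \<in> {a \<in> action_domain l \<alpha>. enn2real (action_seminorm l \<alpha> a) \<le> K \<and> norm a \<le> R}"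
      using a by blast
  qed
qed

section \<open>Almost additive maps and matrix representations\<close>

definition nmult :: "nat \<Rightarrow> 'g::monoid_add \<Rightarrow> 'g" where
  "nmult k x = (((+) x) ^^ k) 0"

lemma nmult_simps: "nmult 0 x = 0" "nmult (Suc k) x = x + nmult k x"
  by (simp_all add: nmult_def)

text \<open>
  As long as \<open>N\<close> stays below \<open>1/2\<close> on the multiples of \<open>x\<close>, almost additivity makes the \<open>k\<close>-th
  multiple deviate from \<open>k\<close> times \<open>M x\<close> by at most half of \<open>k * N x\<close>, so that \<open>k * N x \<le> 1\<close>. Hence
  the first multiple with \<open>N > 1/2\<close> occurs at some \<open>k\<close> of order \<open>1 / N x\<close>. There \<open>l\<close> is at least a
  positive constant \<open>c\<close> by compactness, and at most \<open>k * l x\<close> by subadditivity.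
  
  The family \<open>M\<close> over the index set \<open>I\<close> stands for one map into a finite product, normed by the sum
  of the norms of the components.
\<close>

theorem almost_additive_Lipschitz:
  fixes l :: "'g::topological_group_add \<Rightarrow> real" and M :: "'i \<Rightarrow> 'g \<Rightarrow> 'c::real_normed_vector"
    and I :: "'i set"
  defines "N \<equiv> (\<lambda>x. \<Sum>i\<in>I. norm (M i x))"
  assumes G: "compact (UNIV :: 'g set)" and l: "length_function l"
    and cont: "\<And>i. i \<in> I \<Longrightarrow> continuous_on UNIV (M i)"
    and zero: "\<And>i. i \<in> I \<Longrightarrow> M i 0 = 0"
    and almost: "\<And>x y. (\<Sum>i\<in>I. norm (M i (x + y) - M i x - M i y)) \<le> N x * N y"
  obtains C where "C \<ge> 0" "\<And>x. N x \<le> C * l x"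
proof -
  have N0: "N x \<ge> 0" for x unfolding N_def by (simp add: sum_nonneg)
  have contN: "continuous_on UNIV N" unfolding N_def using cont by (intro continuous_intros)
  have contl: "continuous_on UNIV l" using l unfolding length_function_def by blast
  obtain x1 where x1: "\<And>x. N x \<le> N x1"
    using continuous_attains_sup[OF G _ contN] by auto
  obtain c where c: "c > 0" and far: "\<And>x. N x \<ge> 1/2 \<Longrightarrow> l x \<ge> c"
  proof -
    let ?K = "{x. N x \<ge> 1/2}"
    show ?thesis
    proof (cases "?K = {}")
      case True
      then show ?thesis using that[of 1] by auto
    next
      case False
      have "closed ?K" by (intro closed_Collect_le contN continuous_intros)
      then have "compact ?K" using G by (metis closed_Int_compact inf_top_right)
      then obtain x0 where x0: "x0 \<in> ?K" "\<And>x. x \<in> ?K \<Longrightarrow> l x0 \<le> l x"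
        using continuous_attains_inf[OF _ False continuous_on_subset[OF contl]] by auto
      have "N 0 = 0" unfolding N_def using zero by simp
      then have "x0 \<noteq> 0" using x0(1) by auto
      then show ?thesis using that[of "l x0"] length_function_pos[OF l] x0(2) by auto
    qed
  qed
  have step: "k * N x \<le> 2 * N (nmult k x) \<and> k * N x \<le> 1"
    if small: "\<And>j. j \<le> k \<Longrightarrow> N (nmult j x) \<le> 1/2" for k x
  proof -
    have dev: "j \<le> k \<Longrightarrow> (\<Sum>i\<in>I. norm (M i (nmult j x) - real j *\<^sub>R M i x)) \<le> j * N x / 2" for j
    proof (induction j)
      case 0
      then show ?case using zero by (simp add: nmult_simps)
    next
      case (Suc j)
      have "(\<Sum>i\<in>I. norm (M i (nmult (Suc j) x) - real (Suc j) *\<^sub>R M i x))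
          \<le> (\<Sum>i\<in>I. norm (M i (x + nmult j x) - M i x - M i (nmult j x))
              + norm (M i (nmult j x) - real j *\<^sub>R M i x))"
      proof (rule sum_mono)
        fix i
        have "M i (nmult (Suc j) x) - real (Suc j) *\<^sub>R M i x
            = (M i (x + nmult j x) - M i x - M i (nmult j x)) + (M i (nmult j x) - real j *\<^sub>R M i x)"
          by (simp add: nmult_simps algebra_simps)
        then show "norm (M i (nmult (Suc j) x) - real (Suc j) *\<^sub>R M i x)
            \<le> norm (M i (x + nmult j x) - M i x - M i (nmult j x))
              + norm (M i (nmult j x) - real j *\<^sub>R M i x)"
          by (metis norm_triangle_ineq)
      qed
      also have "\<dots> \<le> N x * N (nmult j x) + j * N x / 2"
        unfolding sum.distrib using almost Suc by (intro add_mono) auto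
      also have "N x * N (nmult j x) \<le> N x * (1/2)"
        using small[of j] Suc.prems N0 by (intro mult_left_mono) auto
      finally show ?case by (simp add: field_simps)
    qed
    have "k * N x = (\<Sum>i\<in>I. norm (real k *\<^sub>R M i x))"
      unfolding N_def by (simp add: sum_distrib_left)
    also have "\<dots> \<le> (\<Sum>i\<in>I. norm (M i (nmult k x)) + norm (M i (nmult k x) - real k *\<^sub>R M i x))"
      by (intro sum_mono) (metis norm_triangle_sub norm_minus_commute)
    also have "\<dots> \<le> N (nmult k x) + k * N x / 2"
      unfolding sum.distrib using dev[of k] by (intro add_mono) (simp_all add: N_def)
    finally show ?thesis using small[of k] by auto
  qed
  have lk: "l (nmult k x) \<le> k * l x" for k x
  proof (induction k)
    case 0
    have "l 0 = 0" using l unfolding length_function_def by blast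
    then show ?case by (simp add: nmult_simps)
  next
    case (Suc k)
    have "l (nmult (Suc k) x) \<le> l x + l (nmult k x)"
      using l unfolding nmult_simps length_function_def by blast
    then show ?case using Suc by (simp add: distrib_right)
  qed
  have "N x \<le> ((1 + N x1) / c) * l x" for x
  proof (cases "N x = 0")
    case True
    then show ?thesis using length_function_nonneg[OF l] c N0[of x1] by simp
  next
    case False
    then have pos: "N x > 0" using N0[of x] by simp
    have "\<exists>k. N (nmult k x) > 1/2"
    proof (rule ccontr)
      assume "\<not> ?thesis"
      then have "N (nmult j x) \<le> 1/2" for j by (simp add: not_less)
      then have le: "k * N x \<le> 1" for k :: nat using step[of k x] by blast
      obtain k :: nat where "1 < k * N x" using reals_Archimedean3[OF pos] by blast
      then show False using le[of k] by simp
    qed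
    then obtain k where k: "N (nmult k x) > 1/2" and least: "\<And>j. j < k \<Longrightarrow> N (nmult j x) \<le> 1/2"
      unfolding exists_least_iff[of "\<lambda>k. N (nmult k x) > 1/2"] by (meson not_less)
    have "N (nmult 0 x) = 0" unfolding N_def nmult_simps using zero by simp
    then obtain m where m: "k = Suc m" using k by (cases k) auto
    \<comment> \<open>The preceding multiple is still in the small range; passing from \<open>m\<close> to \<open>Suc m\<close> costs at
      most the maximum \<open>N x1\<close>.\<close>
    have "m * N x \<le> 1" using step[of m x] least m by auto
    then have kN: "k * N x \<le> 1 + N x1" using x1[of x] m by (simp add: algebra_simps)
    have "c \<le> k * l x" using far[of "nmult k x"] k lk[of k x] by simp
    then have "c * N x \<le> (k * l x) * N x" using pos by (intro mult_right_mono) auto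
    also have "\<dots> = (k * N x) * l x" by simp
    also have "\<dots> \<le> (1 + N x1) * l x" using kN length_function_nonneg[OF l] by (intro mult_right_mono)
    finally show ?thesis using c by (simp add: field_simps)
  qed
  then show ?thesis using that[of "(1 + N x1) / c"] N0[of x1] c by simp
qed

lemma irreducible_repD:
  assumes "irreducible_rep \<pi>"
  shows "matrix_rep \<pi>" "\<pi> x \<in> carrier_mat (rep_dim \<pi>) (rep_dim \<pi>)"
    "invariant_subspace \<pi> W \<Longrightarrow> W = {0\<^sub>v (rep_dim \<pi>)} \<or> W = carrier_vec (rep_dim \<pi>)"
  using assms by (simp_all add: irreducible_rep_def matrix_rep_def)

text \<open>
  The entries of \<open>\<pi> x - 1\<close> are almost additive: the defect is the matrix product of \<open>\<pi> x - 1\<close> and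
  \<open>\<pi> y - 1\<close>, and the sum of the absolute values of all entries is a submultiplicative norm.
\<close>

theorem matrix_rep_Lipschitz:
  fixes l :: "'g::topological_group_add \<Rightarrow> real" and \<pi> :: "'g \<Rightarrow> complex mat"
  assumes G: "compact (UNIV :: 'g set)" and l: "length_function l" and \<pi>: "matrix_rep \<pi>"
  obtains K where "K \<ge> 0"
    "\<And>x i j. i < rep_dim \<pi> \<Longrightarrow> j < rep_dim \<pi> \<Longrightarrow>
       cmod (\<pi> x $$ (i, j) - (if i = j then 1 else 0)) \<le> K * l x"
proof -
  let ?n = "rep_dim \<pi>"
  have carr: "\<pi> x \<in> carrier_mat ?n ?n" and one: "\<pi> 0 = 1\<^sub>m ?n"
    and mult: "\<pi> (x + y) = \<pi> x * \<pi> y"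
    and cont: "i < ?n \<Longrightarrow> j < ?n \<Longrightarrow> continuous_on UNIV (\<lambda>x. \<pi> x $$ (i, j))" for x y i j
    using \<pi> unfolding matrix_rep_def by blast+
  define \<delta> :: "nat \<Rightarrow> nat \<Rightarrow> complex" where "\<delta> i j = (if i = j then 1 else 0)" for i j
  define M where "M = (\<lambda>(i, j) x. \<pi> x $$ (i, j) - \<delta> i j)"
  define I where "I = {..<?n} \<times> {..<?n}"
  have \<delta>l: "(\<Sum>k<?n. \<delta> i k * f k) = f i" if "i < ?n" for i f
  proof -
    have "(\<Sum>k<?n. \<delta> i k * f k) = (\<Sum>k<?n. if k = i then f k else 0)"
      by (intro sum.cong refl) (simp add: \<delta>_def)
    then show ?thesis using that by simp
  qed
  have \<delta>r: "(\<Sum>k<?n. f k * \<delta> k j) = f j" if "j < ?n" for j f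
  proof -
    have "(\<Sum>k<?n. f k * \<delta> k j) = (\<Sum>k<?n. if k = j then f k else 0)"
      by (intro sum.cong refl) (simp add: \<delta>_def)
    then show ?thesis using that by simp
  qed
  have entry: "M (i, j) (x + y) - M (i, j) x - M (i, j) y = (\<Sum>k<?n. M (i, k) x * M (k, j) y)"
    if ij: "i < ?n" "j < ?n" for i j x y
  proof -
    have "\<pi> (x + y) $$ (i, j) = (\<Sum>k<?n. \<pi> x $$ (i, k) * \<pi> y $$ (k, j))"
      unfolding mult using carr[of x] carr[of y] ij
      by (simp add: scalar_prod_def atLeast0LessThan)
    moreover have "(\<Sum>k<?n. \<delta> i k * \<pi> y $$ (k, j)) = \<pi> y $$ (i, j)"
      "(\<Sum>k<?n. \<pi> x $$ (i, k) * \<delta> k j) = \<pi> x $$ (i, j)"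
      "(\<Sum>k<?n. \<delta> i k * \<delta> k j) = \<delta> i j"
      using ij by (simp_all only: \<delta>l \<delta>r)
    ultimately show ?thesis
      by (simp add: M_def algebra_simps sum.distrib sum_subtractf)
  qed
  obtain K where K: "K \<ge> 0" "\<And>x. (\<Sum>p\<in>I. norm (M p x)) \<le> K * l x"
  proof (rule almost_additive_Lipschitz[OF G l, of I M])
    show "continuous_on UNIV (M p)" if "p \<in> I" for p
      using that cont unfolding I_def M_def by (auto intro!: continuous_intros)
    show "M p 0 = 0" if "p \<in> I" for p
      using that unfolding I_def M_def by (auto simp: one \<delta>_def)
    show "(\<Sum>p\<in>I. norm (M p (x + y) - M p x - M p y)) \<le> (\<Sum>p\<in>I. norm (M p x)) * (\<Sum>p\<in>I. norm (M p y))" for x y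
    proof -
      have "(\<Sum>p\<in>I. norm (M p (x + y) - M p x - M p y))
          = (\<Sum>i<?n. \<Sum>j<?n. norm (\<Sum>k<?n. M (i, k) x * M (k, j) y))"
        unfolding I_def sum.cartesian_product[symmetric] using entry by (auto intro!: sum.cong simp: sum.cartesian_product)
      also have "\<dots> \<le> (\<Sum>i<?n. \<Sum>j<?n. \<Sum>k<?n. norm (M (i, k) x) * norm (M (k, j) y))"
        by (intro sum_mono) (simp add: sum_norm_le norm_mult)
      also have "\<dots> = (\<Sum>i<?n. \<Sum>k<?n. norm (M (i, k) x) * (\<Sum>j<?n. norm (M (k, j) y)))"
        by (simp add: sum_distrib_left) (intro sum.cong refl sum.swap)
      also have "\<dots> \<le> (\<Sum>i<?n. \<Sum>k<?n. norm (M (i, k) x) * (\<Sum>p\<in>I. norm (M p y)))"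
      proof (intro sum_mono mult_left_mono)
        fix k assume "k \<in> {..<?n}"
        then show "(\<Sum>j<?n. norm (M (k, j) y)) \<le> (\<Sum>p\<in>I. norm (M p y))"
          using member_le_sum[of k "{..<?n}" "\<lambda>k. \<Sum>j<?n. norm (M (k, j) y)"]
          by (simp add: I_def sum.cartesian_product sum_nonneg)
      qed simp
      also have "\<dots> = (\<Sum>p\<in>I. norm (M p x)) * (\<Sum>p\<in>I. norm (M p y))"
        by (simp add: I_def sum.cartesian_product sum_distrib_right)
      finally show ?thesis .
    qed
  qed blast
  show ?thesis
  proof (rule that[OF K(1)])
    fix x i j assume "i < ?n" "j < ?n"
    then have "norm (M (i, j) x) \<le> (\<Sum>p\<in>I. norm (M p x))"
      by (intro member_le_sum) (auto simp: I_def)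
    then show "cmod (\<pi> x $$ (i, j) - (if i = j then 1 else 0)) \<le> K * l x"
      using K(2)[of x] unfolding M_def \<delta>_def by simp
  qed
qed

section \<open>Intertwiners into the complexification\<close>

text \<open>
  Unlike the injective maps that define \<open>copies\<close>, these form a vector space.
\<close>

definition intertwiners ::
    "('g::topological_group_add \<Rightarrow> complex mat) \<Rightarrow> ('g \<Rightarrow> 'a \<Rightarrow> 'a) \<Rightarrow>
     (complex Matrix.vec \<Rightarrow> 'a \<times> 'a::real_vector) set" where
  "intertwiners \<pi> \<alpha> = {\<phi>.
     (\<forall>v\<in>carrier_vec (rep_dim \<pi>). \<forall>w\<in>carrier_vec (rep_dim \<pi>). \<phi> (v + w) = \<phi> v + \<phi> w) \<and>
     (\<forall>c. \<forall>v\<in>carrier_vec (rep_dim \<pi>). \<phi> (c \<cdot>\<^sub>v v) = cscale c (\<phi> v)) \<and>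
     (\<forall>x. \<forall>v\<in>carrier_vec (rep_dim \<pi>). \<phi> (\<pi> x *\<^sub>v v) = complexify_action \<alpha> x (\<phi> v))}"

lemma norm_complexify_action:
  assumes "\<And>a. norm (\<alpha> x a) = norm a"
  shows "norm (complexify_action \<alpha> x w) = norm w"
  using assms by (cases w) (simp add: complexify_action_def norm_Pair)

text \<open>
  The norm of a pair is invariant under the real scalars of modulus one and under
  \<open>(u, v) \<mapsto> (- v, u)\<close>, but not in general under multiplication by complex scalars of modulus one,
  whence the factor.
\<close>

lemma norm_cscale_le: "norm (cscale c w) \<le> 2 * cmod c * norm w"
proof (cases w)
  case (Pair u v)
  have "cscale c w = Re c *\<^sub>R (u, v) + Im c *\<^sub>R (- v, u)" by (simp add: cscale_def Pair)
  then have "norm (cscale c w) \<le> norm (Re c *\<^sub>R (u, v)) + norm (Im c *\<^sub>R (- v, u))"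
    by (metis norm_triangle_ineq)
  also have "\<dots> = \<bar>Re c\<bar> * norm w + \<bar>Im c\<bar> * norm w"
    unfolding norm_scaleR by (simp add: Pair norm_Pair add.commute)
  also have "\<dots> \<le> cmod c * norm w + cmod c * norm w"
    by (intro add_mono mult_right_mono abs_Re_le_cmod abs_Im_le_cmod) auto
  finally show ?thesis by simp
qed

text \<open>
  Linearity on \<open>carrier_vec\<close>, applied to the truncations of \<open>v\<close> to its first \<open>k\<close> coordinates.
\<close>

lemma intertwiner_expansion:
  assumes \<phi>: "\<phi> \<in> intertwiners \<pi> \<alpha>" and v: "v \<in> carrier_vec (rep_dim \<pi>)"
  shows "\<phi> v = (\<Sum>i<rep_dim \<pi>. cscale (v $ i) (\<phi> (unit_vec (rep_dim \<pi>) i)))"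
proof -
  let ?n = "rep_dim \<pi>"
  define t where "t k = Matrix.vec ?n (\<lambda>i. if i < k then v $ i else 0)" for k
  have add: "\<phi> (u + w) = \<phi> u + \<phi> w" and scl: "\<phi> (c \<cdot>\<^sub>v u) = cscale c (\<phi> u)"
    if "u \<in> carrier_vec ?n" "w \<in> carrier_vec ?n" for u w c
    using \<phi> that unfolding intertwiners_def by blast+
  have "k \<le> ?n \<Longrightarrow> \<phi> (t k) = (\<Sum>i<k. cscale (v $ i) (\<phi> (unit_vec ?n i)))" for k
  proof (induction k)
    case 0
    have "t 0 = 0 \<cdot>\<^sub>v unit_vec ?n 0" unfolding t_def by (intro eq_vecI) auto
    then show ?case using scl[of "unit_vec ?n 0" "unit_vec ?n 0" 0]
      by (simp add: cscale_def case_prod_unfold zero_prod_def)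
  next
    case (Suc k)
    have "t (Suc k) = t k + v $ k \<cdot>\<^sub>v unit_vec ?n k"
      unfolding t_def using Suc.prems by (intro eq_vecI) (auto simp: less_Suc_eq)
    moreover have "t k \<in> carrier_vec ?n" unfolding t_def by simp
    ultimately show ?case using Suc add[of "t k" "v $ k \<cdot>\<^sub>v unit_vec ?n k"]
      scl[of "unit_vec ?n k" "unit_vec ?n k"] by simp
  qed
  moreover have "t ?n = v" unfolding t_def using v by (intro eq_vecI) auto
  ultimately show ?thesis by (metis order_refl)
qed

text \<open>
  The vectors \<open>u\<close> for which such a bound exists form an invariant subspace, because the action is
  isometric. It contains \<open>v\<close>, hence is everything by irreducibility.
\<close>

lemma cyclic_bound:
  assumes irr: "irreducible_rep \<pi>" and iso: "\<And>x a. norm (\<alpha> x a) = norm a"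
    and v: "v \<in> carrier_vec (rep_dim \<pi>)" "v \<noteq> 0\<^sub>v (rep_dim \<pi>)" and u: "u \<in> carrier_vec (rep_dim \<pi>)"
  obtains K where "K \<ge> 0" "\<And>\<phi>. \<phi> \<in> intertwiners \<pi> \<alpha> \<Longrightarrow> norm (\<phi> u) \<le> K * norm (\<phi> v)"
proof -
  let ?n = "rep_dim \<pi>"
  let ?I = "intertwiners \<pi> \<alpha>"
  define W where "W = {u \<in> carrier_vec ?n. \<exists>K\<ge>0. \<forall>\<phi>\<in>?I. norm (\<phi> u) \<le> K * norm (\<phi> v)}"
  have carr: "\<pi> x \<in> carrier_mat ?n ?n" for x
    by (rule irreducible_repD(2)[OF irr])
  have add: "\<phi> (u + w) = \<phi> u + \<phi> w" and scl: "\<phi> (c \<cdot>\<^sub>v u) = cscale c (\<phi> u)"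
    and equi: "\<phi> (\<pi> x *\<^sub>v u) = complexify_action \<alpha> x (\<phi> u)"
    if "\<phi> \<in> ?I" "u \<in> carrier_vec ?n" "w \<in> carrier_vec ?n" for \<phi> u w c x
    using that unfolding intertwiners_def by blast+
  have "v \<in> W" unfolding W_def using v(1) by (auto intro!: exI[of _ 1])
  have scW: "c \<cdot>\<^sub>v w \<in> W" if wW: "w \<in> W" for c w
  proof -
    obtain K where K: "K \<ge> 0" "\<And>\<phi>. \<phi> \<in> ?I \<Longrightarrow> norm (\<phi> w) \<le> K * norm (\<phi> v)"
      and w: "w \<in> carrier_vec ?n" using wW unfolding W_def by blast
    have "norm (\<phi> (c \<cdot>\<^sub>v w)) \<le> (2 * cmod c * K) * norm (\<phi> v)" if \<phi>: "\<phi> \<in> ?I" for \<phi>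
    proof -
      have "norm (\<phi> (c \<cdot>\<^sub>v w)) \<le> 2 * cmod c * norm (\<phi> w)"
        unfolding scl[OF \<phi> w w] by (rule norm_cscale_le)
      also have "\<dots> \<le> 2 * cmod c * (K * norm (\<phi> v))" using K(2)[OF \<phi>] by (intro mult_left_mono) auto
      finally show ?thesis by (simp add: mult.assoc)
    qed
    then show ?thesis unfolding W_def using w K(1) by (auto intro!: exI[of _ "2 * cmod c * K"])
  qed
  have "invariant_subspace \<pi> W"
    unfolding invariant_subspace_def
  proof (intro conjI ballI allI)
    show "W \<subseteq> carrier_vec ?n" unfolding W_def by blast
    have "0 \<cdot>\<^sub>v v = 0\<^sub>v ?n" using v(1) by (intro eq_vecI) auto
    then show "0\<^sub>v ?n \<in> W" using scW[OF \<open>v \<in> W\<close>, of 0] by simp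
    show "c \<cdot>\<^sub>v w \<in> W" if "w \<in> W" for c w using scW that .
    show "w + w' \<in> W" if ww: "w \<in> W" "w' \<in> W" for w w'
    proof -
      obtain K where K: "K \<ge> 0" "\<And>\<phi>. \<phi> \<in> ?I \<Longrightarrow> norm (\<phi> w) \<le> K * norm (\<phi> v)"
        and w: "w \<in> carrier_vec ?n" using ww(1) unfolding W_def by blast
      obtain K' where K': "K' \<ge> 0" "\<And>\<phi>. \<phi> \<in> ?I \<Longrightarrow> norm (\<phi> w') \<le> K' * norm (\<phi> v)"
        and w': "w' \<in> carrier_vec ?n" using ww(2) unfolding W_def by blast
      have "norm (\<phi> (w + w')) \<le> (K + K') * norm (\<phi> v)" if \<phi>: "\<phi> \<in> ?I" for \<phi>
        unfolding add[OF \<phi> w w'] distrib_right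
        using K(2)[OF \<phi>] K'(2)[OF \<phi>] by (intro norm_triangle_le add_mono)
      then show ?thesis unfolding W_def using w w' K(1) K'(1) by (auto intro!: exI[of _ "K + K'"])
    qed
    show "\<pi> x *\<^sub>v w \<in> W" if "w \<in> W" for x w
    proof -
      have w: "w \<in> carrier_vec ?n" using that unfolding W_def by blast
      have "norm (\<phi> (\<pi> x *\<^sub>v w)) = norm (\<phi> w)" if "\<phi> \<in> ?I" for \<phi>
        unfolding equi[OF that w w] by (rule norm_complexify_action[of \<alpha>, OF iso])
      then show ?thesis using that mult_mat_vec_carrier[OF carr w] unfolding W_def by auto
    qed
  qed
  moreover have "W \<noteq> {0\<^sub>v ?n}" using \<open>v \<in> W\<close> v(2) by blast
  ultimately have "W = carrier_vec ?n" using irreducible_repD(3)[OF irr] by blast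
  then show ?thesis using u that unfolding W_def by blast
qed

text \<open>
  Expanding \<open>\<phi> (\<pi> x e\<^sub>i) - \<phi> e\<^sub>i\<close> in the \<open>\<phi> e\<^sub>j\<close> gives coefficients of size \<open>O(l x)\<close>, and each
  \<open>\<phi> e\<^sub>j\<close> is bounded by a multiple of \<open>\<phi> e\<^sub>i\<close> that does not depend on \<open>\<phi>\<close>.
\<close>

theorem intertwiner_orbit_Lipschitz:
  fixes l :: "'g::topological_group_add \<Rightarrow> real" and \<alpha> :: "'g \<Rightarrow> 'a \<Rightarrow> 'a::real_normed_vector"
  assumes G: "compact (UNIV :: 'g set)" and l: "length_function l"
    and irr: "irreducible_rep \<pi>" and iso: "\<And>x a. norm (\<alpha> x a) = norm a"
    and i: "i < rep_dim \<pi>"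
  obtains K where "K > 0"
    "\<And>\<phi> x. \<phi> \<in> intertwiners \<pi> \<alpha> \<Longrightarrow>
       norm (complexify_action \<alpha> x (\<phi> (unit_vec (rep_dim \<pi>) i)) - \<phi> (unit_vec (rep_dim \<pi>) i))
         \<le> K * norm (\<phi> (unit_vec (rep_dim \<pi>) i)) * l x"
proof -
  let ?n = "rep_dim \<pi>"
  let ?I = "intertwiners \<pi> \<alpha>"
  let ?e = "unit_vec ?n :: nat \<Rightarrow> complex Matrix.vec"
  note \<pi> = irreducible_repD(1)[OF irr] and carr = irreducible_repD(2)[OF irr]
  obtain D where D: "D \<ge> 0" "\<And>x i j. i < ?n \<Longrightarrow> j < ?n \<Longrightarrow>
       cmod (\<pi> x $$ (i, j) - (if i = j then 1 else 0)) \<le> D * l x"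
    using matrix_rep_Lipschitz[OF G l \<pi>] by metis
  have "\<exists>B\<ge>0. \<forall>\<phi>\<in>?I. norm (\<phi> (?e j)) \<le> B * norm (\<phi> (?e i))" for j
    by (rule cyclic_bound[where \<alpha> = \<alpha>, OF irr iso unit_vec_carrier unit_vec_nonzero[OF i] unit_vec_carrier[of _ j]])
      blast
  then obtain B where B: "\<And>j. B j \<ge> 0" "\<And>j \<phi>. \<phi> \<in> ?I \<Longrightarrow> norm (\<phi> (?e j)) \<le> B j * norm (\<phi> (?e i))"
    by metis
  define K where "K = (\<Sum>j<?n. 2 * D * B j)"
  have K0: "K \<ge> 0" unfolding K_def using D(1) B(1) by (simp add: sum_nonneg)
  have "norm (complexify_action \<alpha> x (\<phi> (?e i)) - \<phi> (?e i)) \<le> K * norm (\<phi> (?e i)) * l x"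
    if \<phi>: "\<phi> \<in> ?I" for \<phi> x
  proof -
    have col: "\<pi> x *\<^sub>v ?e i \<in> carrier_vec ?n" using carr[of x] by simp
    have "complexify_action \<alpha> x (\<phi> (?e i)) = \<phi> (\<pi> x *\<^sub>v ?e i)"
      using \<phi> unfolding intertwiners_def by simp
    also have "\<dots> = (\<Sum>j<?n. cscale ((\<pi> x *\<^sub>v ?e i) $ j) (\<phi> (?e j)))"
      by (rule intertwiner_expansion[OF \<phi> col])
    also have "\<dots> = (\<Sum>j<?n. cscale (\<pi> x $$ (j, i)) (\<phi> (?e j)))"
      using carr[of x] i by (intro sum.cong refl) simp
    finally have act: "complexify_action \<alpha> x (\<phi> (?e i)) = \<dots>" .
    have "\<phi> (?e i) = (\<Sum>j<?n. cscale (?e i $ j) (\<phi> (?e j)))"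
      by (rule intertwiner_expansion[OF \<phi>]) simp
    also have "\<dots> = (\<Sum>j<?n. cscale (if j = i then 1 else 0) (\<phi> (?e j)))"
      using i by (intro sum.cong refl) simp
    finally have unit: "\<phi> (?e i) = \<dots>" .
    have "complexify_action \<alpha> x (\<phi> (?e i)) - \<phi> (?e i)
        = (\<Sum>j<?n. cscale (\<pi> x $$ (j, i) - (if j = i then 1 else 0)) (\<phi> (?e j)))"
      unfolding act
      by (subst unit, unfold sum_subtractf[symmetric], intro sum.cong refl)
        (simp add: cscale_def case_prod_unfold algebra_simps)
    also have "norm \<dots> \<le> (\<Sum>j<?n. 2 * (D * l x) * (B j * norm (\<phi> (?e i))))"
    proof (rule sum_norm_le)
      fix j assume "j \<in> {..<?n}"
      then have "cmod (\<pi> x $$ (j, i) - (if j = i then 1 else 0)) \<le> D * l x" using D(2) i by simp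
      then have "2 * cmod (\<pi> x $$ (j, i) - (if j = i then 1 else 0)) * norm (\<phi> (?e j))
          \<le> 2 * (D * l x) * (B j * norm (\<phi> (?e i)))"
        using B(2)[OF \<phi>] D(1) length_function_nonneg[OF l] by (intro mult_mono) auto
      then show "norm (cscale (\<pi> x $$ (j, i) - (if j = i then 1 else 0)) (\<phi> (?e j)))
          \<le> 2 * (D * l x) * (B j * norm (\<phi> (?e i)))"
        using norm_cscale_le order_trans by blast
    qed
    also have "\<dots> = K * norm (\<phi> (?e i)) * l x"
      unfolding K_def sum_distrib_right by (intro sum.cong refl) simp
    finally show ?thesis .
  qed
  then have "norm (complexify_action \<alpha> x (\<phi> (?e i)) - \<phi> (?e i)) \<le> (K + 1) * norm (\<phi> (?e i)) * l x"
    if "\<phi> \<in> ?I" for \<phi> x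
    using that length_function_nonneg[OF l, of x] by (smt (verit) mult_right_mono norm_ge_zero)
  then show ?thesis using that[of "K + 1"] K0 by simp
qed

lemma subspace_intertwiner_values:
  fixes \<alpha> :: "'g::topological_group_add \<Rightarrow> 'a \<Rightarrow> 'a::real_vector"
  assumes lin: "\<And>x. linear (\<alpha> x)" and \<pi>: "matrix_rep \<pi>"
  shows "subspace ((\<lambda>\<phi>. \<phi> v) ` intertwiners \<pi> \<alpha>)"
proof (rule subspaceI)
  interpret vector_space "cscale :: complex \<Rightarrow> 'a \<times> 'a \<Rightarrow> 'a \<times> 'a" by (rule vector_space_cscale)
  have lin': "linear (complexify_action \<alpha> x)" for x
    unfolding complexify_action_def using lin[of x]
    by (intro linearI) (auto simp: linear_add linear_scale)
  have carr: "\<pi> x \<in> carrier_mat (rep_dim \<pi>) (rep_dim \<pi>)" for x using \<pi> unfolding matrix_rep_def by blast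
  have "(\<lambda>_. 0) \<in> intertwiners \<pi> \<alpha>"
    unfolding intertwiners_def using lin' by (auto simp: linear_0)
  then show "0 \<in> (\<lambda>\<phi>. \<phi> v) ` intertwiners \<pi> \<alpha>" by (rule image_eqI[rotated]) simp
  fix a b assume "a \<in> (\<lambda>\<phi>. \<phi> v) ` intertwiners \<pi> \<alpha>" 
  then obtain \<phi> where \<phi>: "\<phi> \<in> intertwiners \<pi> \<alpha>" "a = \<phi> v" by blast
  show "c *\<^sub>R a \<in> (\<lambda>\<phi>. \<phi> v) ` intertwiners \<pi> \<alpha>" for c
  proof -
    have comm: "c *\<^sub>R cscale d w = cscale d (c *\<^sub>R w)" for d and w :: "'a \<times> 'a"
      by (cases w) (simp add: cscale_def algebra_simps)
    have "(\<lambda>u. c *\<^sub>R \<phi> u) \<in> intertwiners \<pi> \<alpha>"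
      using \<phi>(1) lin' carr unfolding intertwiners_def
      by (auto simp: linear_scale scaleR_add_right comm)
    then show ?thesis using \<phi>(2) by (intro image_eqI[of _ _ "\<lambda>u. c *\<^sub>R \<phi> u"]) auto
  qed
  assume "b \<in> (\<lambda>\<phi>. \<phi> v) ` intertwiners \<pi> \<alpha>" 
  then obtain \<psi> where \<psi>: "\<psi> \<in> intertwiners \<pi> \<alpha>" "b = \<psi> v" by blast
  have "(\<lambda>u. \<phi> u + \<psi> u) \<in> intertwiners \<pi> \<alpha>"
    using \<phi>(1) \<psi>(1) lin' carr unfolding intertwiners_def
    by (auto simp: linear_add scale_right_distrib)
  then show "a + b \<in> (\<lambda>\<phi>. \<phi> v) ` intertwiners \<pi> \<alpha>"
    using \<phi>(2) \<psi>(2) by (intro image_eqI[of _ _ "\<lambda>u. \<phi> u + \<psi> u"]) auto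
qed

text \<open>
  Both components of an element of the unit ball of this subspace lie in a single ball of Lipschitz
  elements.
\<close>

theorem intertwiner_values_finite_spanned:
  fixes l :: "'g::topological_group_add \<Rightarrow> real" and e :: "'a::{banach, ordered_real_vector}"
  assumes G: "compact (UNIV :: 'g set)" and l: "length_function l"
    and C: "complete_order_unit_space e" and \<alpha>: "ou_action e \<alpha>"
    and Lip: "Lip_norm (action_domain l \<alpha>) e (\<lambda>a. enn2real (action_seminorm l \<alpha> a))"
    and irr: "irreducible_rep \<pi>" and i: "i < rep_dim \<pi>"
  obtains B where "finite B" "(\<lambda>\<phi>. \<phi> (unit_vec (rep_dim \<pi>) i)) ` intertwiners \<pi> \<alpha> \<subseteq> span B"
proof -
  let ?e = "unit_vec (rep_dim \<pi>) i :: complex Matrix.vec"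
  define S where "S = (\<lambda>\<phi>. \<phi> ?e) ` intertwiners \<pi> \<alpha>"
  have lin: "linear (\<alpha> x)" for x using \<alpha> unfolding ou_action_def ou_automorphism_def by blast
  note \<pi> = irreducible_repD(1)[OF irr]
  have sub: "subspace S" unfolding S_def by (rule subspace_intertwiner_values[OF lin \<pi>])
  obtain K where K: "K > 0" "\<And>\<phi> x. \<phi> \<in> intertwiners \<pi> \<alpha> \<Longrightarrow>
      norm (complexify_action \<alpha> x (\<phi> ?e) - \<phi> ?e) \<le> K * norm (\<phi> ?e) * l x"
    by (rule intertwiner_orbit_Lipschitz[where \<alpha> = \<alpha>, OF G l irr ou_action_isometric[OF C \<alpha>] i])
      (rule that)
  let ?D = "{a. (\<forall>x. norm (\<alpha> x a - a) \<le> K * l x) \<and> norm a \<le> 1}"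
  have D: "finitely_partitioned ?D"
    by (rule Lipschitz_ball_finitely_partitioned[OF l C \<alpha> Lip K(1)])
  have "{w \<in> S. norm w \<le> 1} \<subseteq> ?D \<times> ?D"
  proof
    fix w assume w: "w \<in> {w \<in> S. norm w \<le> 1}"
    have "norm (complexify_action \<alpha> x w - w) \<le> K * l x" for x
    proof -
      have "norm (complexify_action \<alpha> x w - w) \<le> K * norm w * l x"
        using w K(2) unfolding S_def by auto
      also have "\<dots> \<le> K * 1 * l x"
        using w K(1) length_function_nonneg[OF l] by (intro mult_right_mono mult_left_mono) auto
      finally show ?thesis by simp
    qed
    moreover have "norm (\<alpha> x (fst w) - fst w) \<le> norm (complexify_action \<alpha> x w - w)"
      "norm (\<alpha> x (snd w) - snd w) \<le> norm (complexify_action \<alpha> x w - w)" for x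
      using norm_fst_le[of "fst (complexify_action \<alpha> x w - w)" "snd (complexify_action \<alpha> x w - w)"]
        norm_snd_le[of "snd (complexify_action \<alpha> x w - w)" "fst (complexify_action \<alpha> x w - w)"]
      unfolding complexify_action_def by (cases w, simp)+
    moreover have "norm (fst w) \<le> norm w" "norm (snd w) \<le> norm w"
      using norm_fst_le[of "fst w" "snd w"] norm_snd_le[of "snd w" "fst w"] by simp_all
    ultimately show "w \<in> ?D \<times> ?D"
      using w by (auto simp: mem_Times_iff intro: order_trans)
  qed
  then have "finitely_partitioned {w \<in> S. norm w \<le> 1}"
    using finitely_partitioned_subset[OF finitely_partitioned_Times[OF D D]] by blast
  then show ?thesis
    using subspace_finite_spanned_if_ball_partitioned[OF sub] that unfolding S_def by metis
qed

text \<open>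
  A class contains many matrix representations. Composing with the change of basis \<open>Q\<close> turns the
  intertwiners from any of them into intertwiners from a fixed one, with the same image.
\<close>

lemma intertwiner_of_equivalent_rep:
  assumes \<pi>: "irreducible_rep \<pi>" and \<sigma>: "(\<pi>, \<sigma>) \<in> rep_equiv"
    and \<phi>: "\<phi> \<in> intertwiners \<sigma> \<alpha>" and w: "w \<in> \<phi> ` carrier_vec (rep_dim \<sigma>)"
  obtains \<psi> v where "\<psi> \<in> intertwiners \<pi> \<alpha>" "v \<in> carrier_vec (rep_dim \<pi>)" "w = \<psi> v"
proof -
  obtain P Q where wit: "\<And>x. similar_mat_wit (\<pi> x) (\<sigma> x) P Q" and irr: "irreducible_rep \<sigma>"
    using \<sigma> unfolding rep_equiv_def by auto
  let ?n = "rep_dim \<pi>"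
  have carr: "\<pi> x \<in> carrier_mat ?n ?n" "\<sigma> x \<in> carrier_mat (rep_dim \<sigma>) (rep_dim \<sigma>)" for x
    using irreducible_repD(2) \<pi> irr by blast+
  note D = similar_mat_witD2[OF carr(1) wit]
  have dim: "rep_dim \<sigma> = ?n" using D(5)[of 0] carr(2)[of 0] by auto
  have PQ: "P \<in> carrier_mat ?n ?n" "Q \<in> carrier_mat ?n ?n" "Q * P = 1\<^sub>m ?n"
    "\<And>x. \<pi> x = P * \<sigma> x * Q" "\<And>x. \<sigma> x \<in> carrier_mat ?n ?n"
    using D by blast+
  have Q: "Q *\<^sub>v u \<in> carrier_vec ?n" if "u \<in> carrier_vec ?n" for u
    using PQ(2) that by simp
  have shift: "Q *\<^sub>v (\<pi> x *\<^sub>v u) = \<sigma> x *\<^sub>v (Q *\<^sub>v u)" if u: "u \<in> carrier_vec ?n" for x u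
  proof -
    have "\<sigma> x *\<^sub>v (Q *\<^sub>v u) \<in> carrier_vec ?n" by (rule mult_mat_vec_carrier[OF PQ(5) Q[OF u]])
    then have "Q *\<^sub>v (P *\<^sub>v (\<sigma> x *\<^sub>v (Q *\<^sub>v u))) = \<sigma> x *\<^sub>v (Q *\<^sub>v u)"
      using assoc_mult_mat_vec[OF PQ(2) PQ(1)] PQ(3) by (metis one_mult_mat_vec)
    moreover have "\<pi> x *\<^sub>v u = P *\<^sub>v (\<sigma> x *\<^sub>v (Q *\<^sub>v u))"
      unfolding PQ(4) using assoc_mult_mat_vec[OF mult_carrier_mat[OF PQ(1) PQ(5)] PQ(2) u]
        assoc_mult_mat_vec[OF PQ(1) PQ(5) Q[OF u]] by simp
    ultimately show ?thesis by simp
  qed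
  have \<phi>': "\<phi> (u + w) = \<phi> u + \<phi> w" "\<phi> (c \<cdot>\<^sub>v u) = cscale c (\<phi> u)"
    "\<phi> (\<sigma> x *\<^sub>v u) = complexify_action \<alpha> x (\<phi> u)"
    if "u \<in> carrier_vec ?n" "w \<in> carrier_vec ?n" for u w c x
    using \<phi> that unfolding intertwiners_def dim by blast+
  have "(\<lambda>u. \<phi> (Q *\<^sub>v u)) \<in> intertwiners \<pi> \<alpha>"
    unfolding intertwiners_def
  proof (intro CollectI conjI ballI allI)
    fix u w :: "complex Matrix.vec" and c x
    assume u: "u \<in> carrier_vec ?n"
    show "\<phi> (Q *\<^sub>v (c \<cdot>\<^sub>v u)) = cscale c (\<phi> (Q *\<^sub>v u))"
      using \<phi>'(2)[OF Q[OF u] Q[OF u]] mult_mat_vec[OF PQ(2) u] by simp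
    show "\<phi> (Q *\<^sub>v (\<pi> x *\<^sub>v u)) = complexify_action \<alpha> x (\<phi> (Q *\<^sub>v u))"
      using \<phi>'(3)[OF Q[OF u] Q[OF u]] shift[OF u] by simp
    assume w: "w \<in> carrier_vec ?n"
    show "\<phi> (Q *\<^sub>v (u + w)) = \<phi> (Q *\<^sub>v u) + \<phi> (Q *\<^sub>v w)"
      using \<phi>'(1)[OF Q[OF u] Q[OF w]] mult_add_distrib_mat_vec[OF PQ(2) u w] by simp
  qed
  moreover obtain u where u: "u \<in> carrier_vec ?n" "w = \<phi> u" using w dim by auto
  moreover have "P *\<^sub>v u \<in> carrier_vec ?n" using PQ(1) u(1) by simp
  moreover have "Q *\<^sub>v (P *\<^sub>v u) = u"
    using assoc_mult_mat_vec[OF PQ(2) PQ(1) u(1)] PQ(3) u(1) by (metis one_mult_mat_vec)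
  ultimately show ?thesis using that[of "\<lambda>u. \<phi> (Q *\<^sub>v u)" "P *\<^sub>v u"] by simp
qed

theorem theorem8p3:
  fixes l :: "'g::topological_group_add \<Rightarrow> real"
    and e :: "'a::{banach, ordered_real_vector}"
    and \<alpha> :: "'g \<Rightarrow> 'a \<Rightarrow> 'a"
  assumes "compact (UNIV :: 'g set)"
    and "\<exists>x :: 'g. x \<noteq> 0"
    and "length_function l"
    and "complete_order_unit_space e"
    and "ou_action e \<alpha>"
    and "strongly_continuous \<alpha>"
    and "ergodic e \<alpha>"
    and "Lip_norm (action_domain l \<alpha>) e (\<lambda>a. enn2real (action_seminorm l \<alpha> a))"
  shows "finite_multiplicity \<alpha>"
  unfolding finite_multiplicity_def
proof
  fix \<gamma> :: "('g \<Rightarrow> complex mat) set" assume "\<gamma> \<in> dual_classes"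
  then obtain \<pi> where \<pi>: "irreducible_rep \<pi>" and \<gamma>: "\<gamma> = rep_equiv `` {\<pi>}"
    unfolding dual_classes_def by (auto elim: quotientE)
  let ?n = "rep_dim \<pi>"
  let ?e = "unit_vec ?n :: nat \<Rightarrow> complex Matrix.vec"
  interpret C: vector_space "cscale :: complex \<Rightarrow> 'a \<times> 'a \<Rightarrow> 'a \<times> 'a" by (rule vector_space_cscale)
  have "\<exists>B. finite B \<and> (i < ?n \<longrightarrow> (\<lambda>\<phi>. \<phi> (?e i)) ` intertwiners \<pi> \<alpha> \<subseteq> span B)" for i
    using intertwiner_values_finite_spanned[OF assms(1,3-5,8) \<pi>] by (metis finite.emptyI)
  then obtain B where B: "\<And>i. finite (B i)"
    "\<And>i \<phi>. i < ?n \<Longrightarrow> \<phi> \<in> intertwiners \<pi> \<alpha> \<Longrightarrow> \<phi> (?e i) \<in> span (B i)" by (metis image_subset_iff)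
  define U where "U = (\<Union>i<?n. B i)"
  have "span (B i) \<subseteq> C.span U" if "i < ?n" for i
  proof (rule span_minimal)
    show "B i \<subseteq> C.span U" using that unfolding U_def by (auto intro: C.span_base)
    have "c *\<^sub>R w = cscale (of_real c) w" for c and w :: "'a \<times> 'a"
      by (cases w) (simp add: cscale_def)
    then have "c *\<^sub>R w \<in> C.span U" if "w \<in> C.span U" for c w
      using C.span_scale[OF that] by metis
    then show "subspace (C.span U)"
      by (intro subspaceI C.span_zero C.span_add)
  qed
  then have in_span: "\<phi> v \<in> C.span U" if "\<phi> \<in> intertwiners \<pi> \<alpha>" "v \<in> carrier_vec ?n" for \<phi> v
    unfolding intertwiner_expansion[OF that] using B(2)[OF _ that(1)]
    by (intro C.span_sum C.span_scale) blast
  have "\<Union> (copies cscale (complexify_action \<alpha>) \<gamma>) \<subseteq> C.span U"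
  proof
    fix w assume "w \<in> \<Union> (copies cscale (complexify_action \<alpha>) \<gamma>)"
    then obtain \<sigma> \<phi> where "\<sigma> \<in> \<gamma>" "\<phi> \<in> intertwiners \<sigma> \<alpha>" "w \<in> \<phi> ` carrier_vec (rep_dim \<sigma>)"
      unfolding copies_def intertwiners_def bij_betw_def by blast
    then show "w \<in> C.span U"
      using intertwiner_of_equivalent_rep[OF \<pi>] in_span unfolding \<gamma> by (metis Image_singleton_iff)
  qed
  then have "isotypic_component cscale (complexify_action \<alpha>) \<gamma> \<subseteq> C.span U"
    unfolding isotypic_component_def by (rule C.span_minimal) (rule C.subspace_span)
  moreover have "finite U" unfolding U_def using B(1) by simp
  ultimately show "rep_multiplicity cscale (complexify_action \<alpha>) \<gamma> < \<infinity>"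
    unfolding rep_multiplicity_def Let_def by auto
qed

end
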